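(* Let $a,b,c,d$ be positive integers with $a+b=c+d$ such that $abcd$ is not a perfect square, and let $L_4(x,y,z,w)=ax+by-cz-dw$. Then there exists $\varepsilon_{L_4}>0$, depending only on $L_4$, such that \[ r_{L_4}(N)=\Omega\left(N^{1/2+\varepsilon_{L_4}}\right), \] i.e. there is a constant $C>0$ (depending on $L_4$) such that $r_{L_4}(N)\ge C\,N^{1/2+\varepsilon_{L_4}}$ for all integers $N\ge 1$.
   Context: Let $L(x_1,\dots,x_s)=c_1x_1+\dots+c_sx_s$ with $c_i\in\mathbb{Z}\setminus\{0\}$ and $c_1+\dots+c_s=0$. For a solution $(x_1,\dots,x_s)\in\mathbb{Z}^s$ to $L=0$, let $\mathcal T$ be the partition of $[s]=\{1,\dots,s\}$ in which $i,j$ lie in the same block if and only if $x_i=x_j$. The solution is called trivial if $\sum_{i\in T}c_i=0$ for all $T\in\mathcal T$, and nontrivial otherwise. A set $A\subseteq\mathbb{Z}$ is $L$-free if all solutions $(x_1,\dots,x_s)\in A^s$ to $L=0$ are trivial. Define $r_L(N)=\max\{|A| : A\subseteq\{1,\dots,N\} \text{ is } L\text{-free}\}$. *)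

theory Defs
  imports Complex_Main "HOL-Computational_Algebra.Nth_Powers"
begin

text \<open>
  A linear form \<open>c\<^sub>1 x\<^sub>1 + \<dots> + c\<^sub>s x\<^sub>s\<close> is represented by its list of
  coefficients \<open>cs\<close>, and a vector in \<open>\<int>\<^sup>s\<close> by a list of the same length;
  the index set \<open>[s]\<close> becomes \<open>{..<length cs}\<close>.
\<close>

definition linear_form :: "int list \<Rightarrow> int list \<Rightarrow> int" where
  "linear_form cs xs = (\<Sum>i<length cs. cs ! i * xs ! i)"

definition is_solution :: "int list \<Rightarrow> int list \<Rightarrow> bool" where
  "is_solution cs xs \<longleftrightarrow> length xs = length cs \<and> linear_form cs xs = 0"

definition value_partition :: "int list \<Rightarrow> nat set set" where
  "value_partition xs =
     {..<length xs} // {(i, j). i < length xs \<and> j < length xs \<and> xs ! i = xs ! j}"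

definition trivial_solution :: "int list \<Rightarrow> int list \<Rightarrow> bool" where
  "trivial_solution cs xs \<longleftrightarrow>
     is_solution cs xs \<and> (\<forall>T\<in>value_partition xs. (\<Sum>i\<in>T. cs ! i) = 0)"

definition L_free :: "int list \<Rightarrow> int set \<Rightarrow> bool" where
  "L_free cs A \<longleftrightarrow>
     (\<forall>xs. set xs \<subseteq> A \<and> is_solution cs xs \<longrightarrow> trivial_solution cs xs)"

definition r_L :: "int list \<Rightarrow> nat \<Rightarrow> nat" where
  "r_L cs N = Max {card A | A. A \<subseteq> {1..int N} \<and> L_free cs A}"

text \<open>The maximum above is over a finite nonempty set as soon as the form has a variable.\<close>

lemma L_free_empty: "cs \<noteq> [] \<Longrightarrow> L_free cs {}"
  by (auto simp: L_free_def is_solution_def)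

lemma finite_card_L_free: "finite {card A | A. A \<subseteq> {1..int N} \<and> L_free cs A}"
proof -
  have "{card A | A. A \<subseteq> {1..int N} \<and> L_free cs A} \<subseteq> card ` Pow {1..int N}"
    by auto
  then show ?thesis
    by (rule finite_subset) simp
qed

end

theory Submission
  imports Defs "HOL-Combinatorics.Multiset_Permutations" "HOL-Computational_Algebra.Squarefree"
begin

text \<open>
  Since \<open>abcd\<close> is not a square, some prime \<open>p\<close> divides it to an odd power. Up to order and a common
  factor the coefficients are \<open>p\<^sup>k a, p\<^sup>l b, c, d\<close> with \<open>p\<close> dividing none of the four cofactors,
  \<open>l < k\<close> and \<open>k + l\<close> odd. Let \<open>q\<close> be a binary quadratic form that is anisotropic modulo \<open>p\<close>. On the
  quadruples of plane vectors that solve the equation, modulo translations, the combination of the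
  values of \<open>q\<close> is a quaternary form that is anisotropic over the \<open>p\<close>-adic numbers, so the points
  \<open>(s, q s)\<close> have no nontrivial solution. This set alone gives the exponent \<open>1/2\<close>.

  For the gain, cut \<open>s\<close> into base-\<open>p\<^sup>k\<^sup>+\<^sup>1\<close> digits and, whenever a digit of \<open>s\<close> vanishes, allow an extra
  bit to be added to \<open>q s\<close> at the corresponding place. This creates nontrivial solutions, but
  valuations show that they are one-sided: where the bits first disagree, two fixed variables always
  differ in the same direction. Hence they disappear if one passes to
  vectors of such points in which all points occur equally often: all orderings of the set of
  points. There are \<open>n!\<close> of these, which loses only a factor \<open>e\<close> per coordinate, whereas the extra bits
  gain \<open>(1 + p\<^sup>-\<^sup>2\<^sup>k\<^sup>-\<^sup>2)\<^sup>T\<close> for points with \<open>T\<close> digits.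
\<close>

section \<open>An anisotropic form at a ramified prime\<close>

text \<open>The form is the homogenization of a polynomial X^2 - X - c without roots modulo p. Such
  a c exists because X^2 - X takes the same value at 0 and 1 and therefore misses a residue; this
  argument also covers p = 2. Nonnegative coefficients serve to keep the later heights
  nonnegative.\<close>

lemma exists_anisotropic_binary_form:
  fixes p :: int
  assumes "prime p"
  shows "\<exists>u v. 0 \<le> u \<and> 0 \<le> v \<and>
    (\<forall>s t. p dvd s\<^sup>2 + u * s * t + v * t\<^sup>2 \<longrightarrow> p dvd s \<and> p dvd t)"
proof -
  have p2: "p \<ge> 2"
    using assms by (simp add: prime_ge_2_int)
  define f where "f = (\<lambda>X::int. (X\<^sup>2 - X) mod p)"
  have "\<not> inj_on f {0..<p}"
  proof
    assume "inj_on f {0..<p}"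
    moreover have "f 0 = f 1" "0 \<in> {0..<p}" "1 \<in> {0..<p}"
      using p2 by (simp_all add: f_def)
    ultimately show False
      by (metis inj_onD zero_neq_one)
  qed
  then have "f ` {0..<p} \<noteq> {0..<p}"
    using endo_inj_surj eq_card_imp_inj_on by (metis finite_atLeastLessThan_int)
  moreover have "f ` {0..<p} \<subseteq> {0..<p}"
    using p2 by (auto simp: f_def)
  ultimately obtain c where c: "c \<in> {0..<p}" "c \<notin> f ` {0..<p}"
    by blast
  have no_root: "\<not> p dvd X\<^sup>2 - X - c" for X
  proof
    assume "p dvd X\<^sup>2 - X - c"
    then have "(X\<^sup>2 - X) mod p = c mod p"
      by (simp add: mod_eq_dvd_iff)
    moreover have "((X mod p)\<^sup>2 - X mod p) mod p = (X\<^sup>2 - X) mod p"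
      by (intro mod_diff_cong) (simp_all add: power_mod)
    ultimately have "f (X mod p) = c"
      using c(1) by (simp add: f_def)
    moreover have "X mod p \<in> {0..<p}"
      using p2 by simp
    ultimately show False
      using c(2) by blast
  qed
  \<comment> \<open>The coefficients -1 and -c are shifted by p to become nonnegative.\<close>
  have "p dvd s \<and> p dvd t" if "p dvd s\<^sup>2 + (p - 1) * s * t + (p - c) * t\<^sup>2" for s t
  proof -
    from that
    have "p dvd (s\<^sup>2 + (p - 1) * s * t + (p - c) * t\<^sup>2) - p * (s * t + t\<^sup>2)"
      by simp
    then have d: "p dvd s\<^sup>2 - s * t - c * t\<^sup>2"
      by (simp add: algebra_simps)
    have "p dvd t"
    proof (rule ccontr)
      assume "\<not> p dvd t"
      then have "coprime t p"
        using assms by (simp add: coprime_commute prime_imp_coprime)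
      then obtain r m where r: "r * t + m * p = 1"
        using bezout_int[of t p] by (auto simp: coprime_iff_gcd_eq_1)
      \<comment> \<open>With r an inverse of t modulo p, the number r s would be a root of X^2 - X -
        c.\<close>
      have "r * t = 1 - m * p"
        using r by simp
      then have "(r * s)\<^sup>2 - r * s - c = r\<^sup>2 * (s\<^sup>2 - s * t - c * t\<^sup>2)
        - m * p * (r * s) + c * ((1 - m * p)\<^sup>2 - 1)"
        by algebra
      also have "\<dots> = r\<^sup>2 * (s\<^sup>2 - s * t - c * t\<^sup>2) + p * (c * (m\<^sup>2 * p - 2 * m) - m * (r * s))"
        by algebra
      finally show False
        using no_root[of "r * s"] d by simp
    qed
    moreover from this have "p dvd s\<^sup>2"
    proof -
      have "p dvd t * (s + c * t)"
        using \<open>p dvd t\<close> by (rule dvd_mult2)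
      with d have "p dvd (s\<^sup>2 - s * t - c * t\<^sup>2) + t * (s + c * t)"
        by (rule dvd_add)
      then show ?thesis
        by (simp add: power2_eq_square algebra_simps)
    qed
    ultimately show "p dvd s \<and> p dvd t"
      using assms prime_dvd_power by blast
  qed
  moreover have "0 \<le> p - 1" "0 \<le> p - c"
    using p2 c(1) by auto
  ultimately show ?thesis
    by blast
qed

section \<open>The quaternary form attached to the equation\<close>

text \<open>Two coefficients are units because a zero sum forces the least valuation to occur at
  least twice. Signs are absorbed into the cofactors, and l = 0 is allowed.\<close>

locale ramified_form =
  fixes p :: int and k l :: nat and a b c d u v :: int
  assumes prime_p: "prime p"
    and l_less_k: "l < k" and odd_kl: "odd (k + l)"
    and units: "\<not> p dvd a" "\<not> p dvd b" "\<not> p dvd c" "\<not> p dvd d"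
    and sum_zero: "p ^ k * a + p ^ l * b + c + d = 0"
    and form_nonneg: "0 \<le> u" "0 \<le> v"
    and anisotropic: "\<And>s t. p dvd s\<^sup>2 + u * s * t + v * t\<^sup>2 \<Longrightarrow> p dvd s \<and> p dvd t"
begin

definition lin :: "int \<Rightarrow> int \<Rightarrow> int \<Rightarrow> int \<Rightarrow> int" where
  "lin x y z w = p ^ k * a * x + p ^ l * b * y + c * z + d * w"

definition qf :: "int \<Rightarrow> int \<Rightarrow> int" where
  "qf s t = s\<^sup>2 + u * s * t + v * t\<^sup>2"

text \<open>The polarization \<open>qf (s + s') (t + t') - qf s t - qf s' t'\<close>, not halved, so
  that p = 2 needs no separate treatment.\<close>

definition polar :: "int \<Rightarrow> int \<Rightarrow> int \<Rightarrow> int \<Rightarrow> int" where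
  "polar s t s' t' = 2 * s * s' + u * (s * t' + s' * t) + 2 * v * t * t'"

text \<open>
  The combination of the values of \<open>qf\<close>, multiplied by \<open>c\<close>, as a form in the differences to the
  fourth variable; the third difference is eliminated by the linear equation.
\<close>
definition quat :: "int \<Rightarrow> int \<Rightarrow> int \<Rightarrow> int \<Rightarrow> int" where
  "quat x\<^sub>1 x\<^sub>2 y\<^sub>1 y\<^sub>2 = p ^ k * (a * (c + p ^ k * a)) * qf x\<^sub>1 x\<^sub>2
     + p ^ l * (b * (c + p ^ l * b)) * qf y\<^sub>1 y\<^sub>2 + p ^ (k + l) * (a * b * polar x\<^sub>1 x\<^sub>2 y\<^sub>1 y\<^sub>2)"

lemma p_pos: "p > 0" and p_ge_2: "p \<ge> 2"
  using prime_p prime_ge_2_int prime_gt_0_int by auto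

lemma lin_diff: "lin x y z w = p ^ k * a * (x - w) + p ^ l * b * (y - w) + c * (z - w)"
proof -
  have "lin x y z w = p ^ k * a * (x - w) + p ^ l * b * (y - w) + c * (z - w)
      + (p ^ k * a + p ^ l * b + c + d) * w"
    by (simp add: lin_def algebra_simps)
  then show ?thesis
    by (simp add: sum_zero)
qed

lemma lin_same [simp]: "lin x x x x = 0"
  by (simp add: lin_diff)

text \<open>Expanding \<open>qf\<close> around the fourth point leaves its values at the differences
  plus terms linear in them, which vanish by the two linear equations. The factor c allows the third
  difference to be eliminated without division.\<close>

lemma lin_qf:
  assumes "lin x\<^sub>1 y\<^sub>1 z\<^sub>1 w\<^sub>1 = 0" "lin x\<^sub>2 y\<^sub>2 z\<^sub>2 w\<^sub>2 = 0"
  shows "c * lin (qf x\<^sub>1 x\<^sub>2) (qf y\<^sub>1 y\<^sub>2) (qf z\<^sub>1 z\<^sub>2) (qf w\<^sub>1 w\<^sub>2)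
    = quat (x\<^sub>1 - w\<^sub>1) (x\<^sub>2 - w\<^sub>2) (y\<^sub>1 - w\<^sub>1) (y\<^sub>2 - w\<^sub>2)"
proof -
  define A B where "A = p ^ k * a" and "B = p ^ l * b"
  define X1 Y1 Z1 X2 Y2 Z2 where "X1 = x\<^sub>1 - w\<^sub>1" and "Y1 = y\<^sub>1 - w\<^sub>1" and "Z1 = z\<^sub>1 - w\<^sub>1"
    and "X2 = x\<^sub>2 - w\<^sub>2" and "Y2 = y\<^sub>2 - w\<^sub>2" and "Z2 = z\<^sub>2 - w\<^sub>2"
  note D = X1_def Y1_def Z1_def X2_def Y2_def Z2_def
  have 1: "A * X1 + B * Y1 + c * Z1 = 0" and 2: "A * X2 + B * Y2 + c * Z2 = 0"
    using assms by (auto simp: lin_diff A_def B_def D)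
  have q: "qf (w\<^sub>1 + s) (w\<^sub>2 + t) - qf w\<^sub>1 w\<^sub>2 = qf s t + (2 * w\<^sub>1 + u * w\<^sub>2) * s + (u * w\<^sub>1 + 2 * v * w\<^sub>2) * t"
    for s t by (simp add: qf_def power2_eq_square algebra_simps)
  note qx = q[of X1 X2, unfolded D, simplified, folded D]
    and qy = q[of Y1 Y2, unfolded D, simplified, folded D]
    and qz = q[of Z1 Z2, unfolded D, simplified, folded D]
  have "lin (qf x\<^sub>1 x\<^sub>2) (qf y\<^sub>1 y\<^sub>2) (qf z\<^sub>1 z\<^sub>2) (qf w\<^sub>1 w\<^sub>2)
    = A * (qf x\<^sub>1 x\<^sub>2 - qf w\<^sub>1 w\<^sub>2) + B * (qf y\<^sub>1 y\<^sub>2 - qf w\<^sub>1 w\<^sub>2) + c * (qf z\<^sub>1 z\<^sub>2 - qf w\<^sub>1 w\<^sub>2)"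
    by (simp add: lin_diff A_def B_def)
  also have "\<dots> = A * qf X1 X2 + B * qf Y1 Y2 + c * qf Z1 Z2
      + (2 * w\<^sub>1 + u * w\<^sub>2) * (A * X1 + B * Y1 + c * Z1) + (u * w\<^sub>1 + 2 * v * w\<^sub>2) * (A * X2 + B * Y2 + c * Z2)"
    unfolding qx qy qz by (simp add: algebra_simps)
  finally have "c * lin (qf x\<^sub>1 x\<^sub>2) (qf y\<^sub>1 y\<^sub>2) (qf z\<^sub>1 z\<^sub>2) (qf w\<^sub>1 w\<^sub>2)
      = c * A * qf X1 X2 + c * B * qf Y1 Y2 + c\<^sup>2 * qf Z1 Z2"
    unfolding 1 2 by (simp add: power2_eq_square algebra_simps)
  also have "c\<^sup>2 * qf Z1 Z2 = qf (c * Z1) (c * Z2)"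
    by (simp add: qf_def power2_eq_square algebra_simps)
  also have "\<dots> = qf (- (A * X1 + B * Y1)) (- (A * X2 + B * Y2))"
    using 1 2 by (simp add: add_eq_0_iff)
  also have "c * A * qf X1 X2 + c * B * qf Y1 Y2 + \<dots>
      = A * (c + A) * qf X1 X2 + B * (c + B) * qf Y1 Y2 + A * B * polar X1 X2 Y1 Y2"
    by (simp add: qf_def polar_def power2_eq_square algebra_simps)
  also have "\<dots> = quat X1 X2 Y1 Y2"
    by (simp add: quat_def A_def B_def power_add algebra_simps)
  finally show ?thesis
    by (simp add: D)
qed

text \<open>For l = 0 the factor c + b could a priori vanish modulo p; the zero sum turns it into
  -(d + p^k a), a unit.\<close>

lemma units_combined: "\<not> p dvd a * (c + p ^ k * a)" "\<not> p dvd b * (c + p ^ l * b)"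
proof -
  have pk: "p dvd p ^ k * a"
    using l_less_k by (simp add: dvd_mult2 dvd_power)
  then have "\<not> p dvd c + p ^ k * a"
    using units by (simp add: dvd_add_left_iff)
  moreover have "c + p ^ l * b = - (d + p ^ k * a)"
    using sum_zero by simp
  then have "\<not> p dvd c + p ^ l * b"
    using units(4) pk by (metis dvd_add_left_iff dvd_minus_iff)
  ultimately show "\<not> p dvd a * (c + p ^ k * a)" "\<not> p dvd b * (c + p ^ l * b)"
    using units prime_p prime_dvd_mult_iff by blast+
qed

lemma qf_scale: "qf (r * s) (r * t) = r\<^sup>2 * qf s t"
  by (simp add: qf_def power2_eq_square algebra_simps)

lemma quat_scale:
  "quat (p ^ i * x\<^sub>1) (p ^ i * x\<^sub>2) (p ^ j * y\<^sub>1) (p ^ j * y\<^sub>2)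
   = p ^ (k + 2 * i) * (a * (c + p ^ k * a) * qf x\<^sub>1 x\<^sub>2)
     + p ^ (l + 2 * j) * (b * (c + p ^ l * b) * qf y\<^sub>1 y\<^sub>2)
     + p ^ (k + l + i + j) * (a * b * polar x\<^sub>1 x\<^sub>2 y\<^sub>1 y\<^sub>2)"
proof -
  have "polar (p ^ i * x\<^sub>1) (p ^ i * x\<^sub>2) (p ^ j * y\<^sub>1) (p ^ j * y\<^sub>2) = p ^ (i + j) * polar x\<^sub>1 x\<^sub>2 y\<^sub>1 y\<^sub>2"
    by (simp add: polar_def power_add algebra_simps)
  moreover have "(p ^ n)\<^sup>2 = p ^ (2 * n)" for n
    by (simp add: power_mult mult.commute flip: power_mult)
  ultimately show ?thesis
    unfolding quat_def qf_scale by (simp only: power_add mult.assoc mult.left_commute mult.commute)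
qed

text \<open>The polar term does no harm: its exponent k + l + i + j is at least the mean of the
  exponents of the two main terms.\<close>

lemma power_dvd_quat:
  assumes "p ^ i dvd x\<^sub>1" "p ^ i dvd x\<^sub>2" "p ^ j dvd y\<^sub>1" "p ^ j dvd y\<^sub>2"
    and "M \<le> k + 2 * i" "M \<le> l + 2 * j"
  shows "p ^ M dvd quat x\<^sub>1 x\<^sub>2 y\<^sub>1 y\<^sub>2"
proof -
  obtain x\<^sub>1' x\<^sub>2' y\<^sub>1' y\<^sub>2' where "x\<^sub>1 = p ^ i * x\<^sub>1'" "x\<^sub>2 = p ^ i * x\<^sub>2'" "y\<^sub>1 = p ^ j * y\<^sub>1'" "y\<^sub>2 = p ^ j * y\<^sub>2'"
    using assms(1-4) unfolding dvd_def by blast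
  moreover have "M \<le> k + l + i + j"
    using assms(5,6) by simp
  ultimately show ?thesis
    using assms(5,6) by (auto simp: quat_scale intro!: dvd_add dvd_mult2 le_imp_power_dvd)
qed

text \<open>
  The two main terms of \<open>quat\<close> have valuations of different parity, hence cannot cancel; this
  determines the divisibility of both arguments digit by digit.
\<close>
lemma power_dvd_quatD:
  assumes "p ^ M dvd quat x\<^sub>1 x\<^sub>2 y\<^sub>1 y\<^sub>2"
  shows "p ^ ((M + 1 - k) div 2) dvd x\<^sub>1 \<and> p ^ ((M + 1 - k) div 2) dvd x\<^sub>2
       \<and> p ^ ((M + 1 - l) div 2) dvd y\<^sub>1 \<and> p ^ ((M + 1 - l) div 2) dvd y\<^sub>2"
  using assms
proof (induction M)
  case 0
  have "(1 - k) div 2 = 0" "(1 - l) div 2 = 0"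
    by simp_all
  then show ?case by simp
next
  case (Suc M)
  \<comment> \<open>These are (M - k)/2 and (M - l)/2 rounded up, with negative values cut off at
    0.\<close>
  define i j where "i = (M + 1 - k) div 2" and "j = (M + 1 - l) div 2"
  have "p ^ M dvd quat x\<^sub>1 x\<^sub>2 y\<^sub>1 y\<^sub>2"
    using Suc.prems by (meson dvd_trans le_imp_power_dvd le_SucI order_refl)
  from Suc.IH[OF this] obtain x\<^sub>1' x\<^sub>2' y\<^sub>1' y\<^sub>2' where
    eq: "x\<^sub>1 = p ^ i * x\<^sub>1'" "x\<^sub>2 = p ^ i * x\<^sub>2'" "y\<^sub>1 = p ^ j * y\<^sub>1'" "y\<^sub>2 = p ^ j * y\<^sub>2'"
    unfolding i_def j_def dvd_def by blast
  have q: "quat x\<^sub>1 x\<^sub>2 y\<^sub>1 y\<^sub>2 = p ^ (k + 2 * i) * (a * (c + p ^ k * a) * qf x\<^sub>1' x\<^sub>2')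
     + p ^ (l + 2 * j) * (b * (c + p ^ l * b) * qf y\<^sub>1' y\<^sub>2')
     + p ^ (k + l + i + j) * (a * b * polar x\<^sub>1' x\<^sub>2' y\<^sub>1' y\<^sub>2')"
    unfolding eq by (rule quat_scale)
  obtain n where n: "k = l + 2 * n + 1"
    using odd_kl l_less_k by (metis add.assoc even_add less_imp_add_positive oddE)
  have cancel: "p dvd m" if "p ^ Suc M dvd p ^ M * m" for m
    using that p_pos by simp
  \<comment> \<open>Passing from M to M + 1 gains divisibility only for the argument whose main term
    has exponent exactly M. Since k and l differ in parity, this happens for at most one of
    them.\<close>
  consider (x) "k \<le> M" "even (M - k)" | (y) "l \<le> M" "even (M - l)"
    | (none) "\<not> (k \<le> M \<and> even (M - k))" "\<not> (l \<le> M \<and> even (M - l))" by blast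
  then show ?case
  proof cases
    case x
    then obtain m where m: "M = k + 2 * m"
      by (metis add_diff_inverse_nat dvd_def not_le)
    have e: "k + 2 * i = M" and f: "l + 2 * j = Suc M"
      and g: "(Suc M + 1 - k) div 2 = Suc i" "(Suc M + 1 - l) div 2 = j"
      unfolding i_def j_def m n by simp_all
    have h: "Suc M \<le> k + l + i + j"
      using e f l_less_k by linarith
    have "p ^ Suc M dvd p ^ M * (a * (c + p ^ k * a) * qf x\<^sub>1' x\<^sub>2')"
    proof -
      have "p ^ Suc M dvd p ^ Suc M * (b * (c + p ^ l * b) * qf y\<^sub>1' y\<^sub>2')"
        "p ^ Suc M dvd p ^ (k + l + i + j) * (a * b * polar x\<^sub>1' x\<^sub>2' y\<^sub>1' y\<^sub>2')"
        using h by (simp_all only: dvd_mult2 le_imp_power_dvd dvd_refl)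
      then show ?thesis
        using Suc.prems unfolding q e f by (simp only: dvd_add_left_iff)
    qed
    then have "p dvd qf x\<^sub>1' x\<^sub>2'"
      using cancel units_combined(1) prime_dvd_multD[OF prime_p] by meson
    then have "p dvd x\<^sub>1'" "p dvd x\<^sub>2'"
      using anisotropic[of x\<^sub>1' x\<^sub>2'] unfolding qf_def by blast+
    then show ?thesis
      unfolding g eq power_Suc2 by (auto intro: mult_dvd_mono)
  next
    case y
    then obtain m where m: "M = l + 2 * m"
      by (metis add_diff_inverse_nat dvd_def not_le)
    have e: "l + 2 * j = M" and f: "Suc M \<le> k + 2 * i"
      and g: "(Suc M + 1 - k) div 2 = i" "(Suc M + 1 - l) div 2 = Suc j"
      unfolding i_def j_def m n by (simp_all, arith+)
    have h: "Suc M \<le> k + l + i + j"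
      using e f l_less_k by linarith
    have "p ^ Suc M dvd p ^ M * (b * (c + p ^ l * b) * qf y\<^sub>1' y\<^sub>2')"
    proof -
      have "p ^ Suc M dvd p ^ (k + 2 * i) * (a * (c + p ^ k * a) * qf x\<^sub>1' x\<^sub>2')"
        "p ^ Suc M dvd p ^ (k + l + i + j) * (a * b * polar x\<^sub>1' x\<^sub>2' y\<^sub>1' y\<^sub>2')"
        using f h by (simp_all only: dvd_mult2 le_imp_power_dvd)
      then show ?thesis
        using Suc.prems unfolding q e by (simp only: dvd_add_left_iff dvd_add_right_iff)
    qed
    then have "p dvd qf y\<^sub>1' y\<^sub>2'"
      using cancel units_combined(2) prime_dvd_multD[OF prime_p] by meson
    then have "p dvd y\<^sub>1'" "p dvd y\<^sub>2'"
      using anisotropic[of y\<^sub>1' y\<^sub>2'] unfolding qf_def by blast+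
    then show ?thesis
      unfolding g eq power_Suc2 by (auto intro: mult_dvd_mono)
  next
    case none
    have "M < k"
    proof (rule ccontr)
      assume "\<not> M < k"
      then have "even (M - k) \<or> even (M - l)"
        using odd_kl l_less_k by (auto simp: even_diff_nat)
      then show False
        using none \<open>\<not> M < k\<close> l_less_k by auto
    qed
    then have "(Suc M + 1 - k) div 2 = i"
      by (simp add: i_def)
    moreover have "(Suc M + 1 - l) div 2 = j"
      using none(2) by (cases "l \<le> M") (auto simp: j_def Suc_diff_le)
    ultimately show ?thesis
      by (simp add: eq)
  qed
qed

end

section \<open>Points with extra bits\<close>

context ramified_form
begin

text \<open>Digits are compared modulo powers of p up to order k + 1, so these congruences can be
  read off the lowest digit.\<close>

definition base :: int where
  "base = p ^ (k + 1)"

text \<open>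
  A letter consists of a digit of each of the two coordinates and a bit, which may be set only if
  both digits vanish.
\<close>
definition alphabet :: "(int \<times> int \<times> int) set" where
  "alphabet = {0..<base} \<times> {0..<base} \<times> {0} \<union> {(0, 0, 1)}"

definition coord1 :: "(int \<times> int \<times> int) list \<Rightarrow> int" where
  "coord1 = horner_sum fst base"

definition coord2 :: "(int \<times> int \<times> int) list \<Rightarrow> int" where
  "coord2 = horner_sum (\<lambda>h. fst (snd h)) base"

text \<open>The base is squared because \<open>qf\<close> gains this factor when both coordinates
  are shifted by one digit.\<close>

definition bits :: "(int \<times> int \<times> int) list \<Rightarrow> int" where
  "bits = horner_sum (\<lambda>h. snd (snd h)) (base\<^sup>2)"

text \<open>The factor \<open>p ^ (k + l)\<close> makes a bit discrepancy of valuation m appear in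
  \<open>quat\<close> at valuation k + l + m, where parity decides whether the x term or the y term
  accounts for it.\<close>

definition height :: "(int \<times> int \<times> int) list \<Rightarrow> int" where
  "height X = qf (coord1 X) (coord2 X) + p ^ (k + l) * bits X"

definition row_solution where
  "row_solution X Y Z W \<longleftrightarrow>
     lin (coord1 X) (coord1 Y) (coord1 Z) (coord1 W) = 0 \<and>
     lin (coord2 X) (coord2 Y) (coord2 Z) (coord2 W) = 0 \<and>
     lin (height X) (height Y) (height Z) (height W) = 0"

definition agree :: "nat \<Rightarrow> int \<times> int \<times> int \<Rightarrow> int \<times> int \<times> int \<Rightarrow> bool" where
  "agree i g h \<longleftrightarrow> p ^ i dvd fst g - fst h \<and> p ^ i dvd fst (snd g) - fst (snd h)"

definition zeros :: "nat \<Rightarrow> int \<times> int \<times> int \<Rightarrow> bool" where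
  "zeros i g \<longleftrightarrow> p ^ i dvd fst g \<and> p ^ i dvd fst (snd g)"

lemma coord_simps [simp]:
  "coord1 (x # X) = fst x + base * coord1 X" "coord2 (x # X) = fst (snd x) + base * coord2 X"
  "bits (x # X) = snd (snd x) + base\<^sup>2 * bits X"
  "coord1 [] = 0" "coord2 [] = 0" "bits [] = 0"
  by (simp_all add: coord1_def coord2_def bits_def)

lemma lin_add_mult:
  "lin (x + m * x') (y + m * y') (z + m * z') (w + m * w') = lin x y z w + m * lin x' y' z' w'"
  by (simp add: lin_def algebra_simps)

lemma agree_mono: "agree j g h \<Longrightarrow> i \<le> j \<Longrightarrow> agree i g h"
  unfolding agree_def by (meson dvd_trans le_imp_power_dvd)

lemma agree_zeros_iff: "agree i g h \<Longrightarrow> zeros i g \<longleftrightarrow> zeros i h"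
  unfolding agree_def zeros_def by (metis dvd_diff_commute dvd_add_right_iff diff_add_cancel)

lemma zeros_imp_agree: "zeros i g \<Longrightarrow> zeros i h \<Longrightarrow> agree i g h"
  by (auto simp: agree_def zeros_def)

lemma alphabet_bit: "h \<in> alphabet \<Longrightarrow> snd (snd h) = 0 \<or> snd (snd h) = 1"
  by (auto simp: alphabet_def)

lemma alphabet_zeros: "h \<in> alphabet \<Longrightarrow> snd (snd h) \<noteq> 0 \<Longrightarrow> zeros i h"
  by (auto simp: alphabet_def zeros_def)

lemma alphabet_agree_eq:
  assumes "g \<in> alphabet" "h \<in> alphabet" "agree (k + 1) g h" "snd (snd g) = snd (snd h)"
  shows "g = h"
proof -
  have eq: "m = n" if "0 \<le> m" "m < base" "0 \<le> n" "n < base" "base dvd m - n" for m n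
    using that by (metis mod_eq_dvd_iff mod_pos_pos_trivial)
  have "fst g \<in> {0..<base}" "fst h \<in> {0..<base}" "fst (snd g) \<in> {0..<base}" "fst (snd h) \<in> {0..<base}"
    using assms(1,2) p_pos by (auto simp: alphabet_def base_def)
  then show ?thesis
    using assms(3,4) eq unfolding agree_def base_def[symmetric] by (auto simp: prod_eq_iff)
qed

lemma pow_dvd_base: "i \<le> k + 1 \<Longrightarrow> p ^ i dvd base"
  unfolding base_def by (rule le_imp_power_dvd)

section \<open>Valuations in a single row solution\<close>

context
  fixes x y z w :: "int \<times> int \<times> int" and X Y Z W :: "(int \<times> int \<times> int) list"
  assumes sol: "row_solution (x # X) (y # Y) (z # Z) (w # W)"
    and alph: "x \<in> alphabet" "y \<in> alphabet" "z \<in> alphabet" "w \<in> alphabet"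
begin

definition "bit_form = lin (snd (snd x)) (snd (snd y)) (snd (snd z)) (snd (snd w))"

definition "row_quat = quat (coord1 (x # X) - coord1 (w # W)) (coord2 (x # X) - coord2 (w # W))
  (coord1 (y # Y) - coord1 (w # W)) (coord2 (y # Y) - coord2 (w # W))"

text \<open>The height equation trades the \<open>qf\<close> part for the bits, from which the
  lowest place splits off. The valuation of \<open>row_quat\<close> can thus be read from the bits
  and, separately, from the digits.\<close>

lemma row_quat_eq:
  "row_quat = p ^ (k + l) * (- c * (bit_form + p ^ (2 * (k + 1)) * lin (bits X) (bits Y) (bits Z) (bits W)))"
proof -
  have 0: "lin (coord1 (x # X)) (coord1 (y # Y)) (coord1 (z # Z)) (coord1 (w # W)) = 0"
    "lin (coord2 (x # X)) (coord2 (y # Y)) (coord2 (z # Z)) (coord2 (w # W)) = 0"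
    "lin (height (x # X)) (height (y # Y)) (height (z # Z)) (height (w # W)) = 0"
    using sol unfolding row_solution_def by blast+
  have "row_quat = c * lin (qf (coord1 (x # X)) (coord2 (x # X))) (qf (coord1 (y # Y)) (coord2 (y # Y)))
      (qf (coord1 (z # Z)) (coord2 (z # Z))) (qf (coord1 (w # W)) (coord2 (w # W)))"
    using lin_qf[OF 0(1,2)] by (simp add: row_quat_def)
  also have "\<dots> = - c * (p ^ (k + l) * lin (bits (x # X)) (bits (y # Y)) (bits (z # Z)) (bits (w # W)))"
    using 0(3) unfolding height_def lin_add_mult by (simp add: add_eq_0_iff2)
  also have "lin (bits (x # X)) (bits (y # Y)) (bits (z # Z)) (bits (w # W))
      = bit_form + p ^ (2 * (k + 1)) * lin (bits X) (bits Y) (bits Z) (bits W)"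
  proof -
    have "base\<^sup>2 = p ^ (2 * (k + 1))"
      unfolding base_def by (simp only: mult.commute[of 2] power_mult)
    then show ?thesis
      by (simp only: coord_simps lin_add_mult bit_form_def)
  qed
  finally show ?thesis
    by (simp only: mult.left_commute)
qed

lemma agree_iff:
  assumes "i \<le> k + 1"
  shows "agree i x w \<longleftrightarrow> p ^ i dvd coord1 (x # X) - coord1 (w # W) \<and> p ^ i dvd coord2 (x # X) - coord2 (w # W)"
    and "agree i y w \<longleftrightarrow> p ^ i dvd coord1 (y # Y) - coord1 (w # W) \<and> p ^ i dvd coord2 (y # Y) - coord2 (w # W)"
proof -
  have *: "p ^ i dvd (m + base * m') - (n + base * n') \<longleftrightarrow> p ^ i dvd m - n" for m m' n n'
  proof -
    have "(m + base * m') - (n + base * n') = (m - n) + base * (m' - n')"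
      by (simp add: algebra_simps)
    moreover have "p ^ i dvd base * (m' - n')"
      using pow_dvd_base[OF assms] by (rule dvd_mult2)
    ultimately show ?thesis
      by (simp only: dvd_add_left_iff)
  qed
  show "agree i x w \<longleftrightarrow> p ^ i dvd coord1 (x # X) - coord1 (w # W) \<and> p ^ i dvd coord2 (x # X) - coord2 (w # W)"
    "agree i y w \<longleftrightarrow> p ^ i dvd coord1 (y # Y) - coord1 (w # W) \<and> p ^ i dvd coord2 (y # Y) - coord2 (w # W)"
    unfolding agree_def coord_simps * by simp_all
qed

text \<open>Here \<open>power_dvd_quatD\<close> is applied at exponent k + l + m: the x digits agree
  to order (l + m)/2 and the y digits to order (k + m)/2, both rounded up.\<close>

lemma agree_if_bit_form_dvd:
  assumes "p ^ m dvd bit_form" "m \<le> 2 * (k + 1)"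
  shows "i \<le> k + 1 \<Longrightarrow> 2 * i \<le> l + m + 1 \<Longrightarrow> agree i x w"
    and "j \<le> k + 1 \<Longrightarrow> 2 * j \<le> k + m + 1 \<Longrightarrow> agree j y w"
proof -
  have "p ^ m dvd p ^ (2 * (k + 1))"
    using assms(2) by (rule le_imp_power_dvd)
  then have "p ^ m dvd - c * (bit_form + p ^ (2 * (k + 1)) * lin (bits X) (bits Y) (bits Z) (bits W))"
    using assms(1) by (intro dvd_mult dvd_add dvd_mult2)
  then have "p ^ (k + l + m) dvd row_quat"
    unfolding row_quat_eq power_add[of p "k + l" m] by (rule mult_dvd_mono[OF dvd_refl])
  from power_dvd_quatD[OF this[unfolded row_quat_def]]
  have D: "p ^ ((l + m + 1) div 2) dvd coord1 (x # X) - coord1 (w # W)"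
    "p ^ ((l + m + 1) div 2) dvd coord2 (x # X) - coord2 (w # W)"
    "p ^ ((k + m + 1) div 2) dvd coord1 (y # Y) - coord1 (w # W)"
    "p ^ ((k + m + 1) div 2) dvd coord2 (y # Y) - coord2 (w # W)"
    by (simp_all add: add.assoc add.left_commute)
  show "agree i x w" if "i \<le> k + 1" "2 * i \<le> l + m + 1"
    unfolding agree_iff(1)[OF that(1)] using D(1,2) that(2)
    by (meson dvd_trans le_imp_power_dvd less_eq_div_iff_mult_less_eq[THEN iffD2] zero_less_numeral
        mult.commute[THEN ord_eq_le_trans])
  show "agree j y w" if "j \<le> k + 1" "2 * j \<le> k + m + 1"
    unfolding agree_iff(2)[OF that(1)] using D(3,4) that(2)
    by (meson dvd_trans le_imp_power_dvd less_eq_div_iff_mult_less_eq[THEN iffD2] zero_less_numeral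
        mult.commute[THEN ord_eq_le_trans])
qed

text \<open>Agreement of both x and y beyond the valuation of \<open>bit_form\<close> would make
  \<open>row_quat\<close> too divisible, by \<open>power_dvd_quat\<close>; the unit c
  cancels.\<close>

lemma not_agree_if_bit_form_not_dvd:
  assumes "\<not> p ^ (m + 1) dvd bit_form" "m + 1 \<le> 2 * (k + 1)"
    and "i \<le> k + 1" "j \<le> k + 1" "l + m + 1 \<le> 2 * i" "k + m + 1 \<le> 2 * j"
  shows "\<not> (agree i x w \<and> agree j y w)"
proof
  assume "agree i x w \<and> agree j y w"
  then have "p ^ (k + l + (m + 1)) dvd row_quat"
    unfolding row_quat_def agree_iff(1)[OF assms(3)] agree_iff(2)[OF assms(4)]
    using assms(5,6) by (intro power_dvd_quat[of i _ _ j]) auto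
  then have "p ^ (m + 1) dvd - c * (bit_form + p ^ (2 * (k + 1)) * lin (bits X) (bits Y) (bits Z) (bits W))"
    unfolding row_quat_eq power_add[of p "k + l" "m + 1"] using p_pos
    by (simp only: dvd_mult_cancel_left power_not_zero) (auto simp: power_not_zero)
  moreover have "coprime (p ^ (m + 1)) (- c)"
    using units(3) prime_p by (simp add: prime_imp_coprime)
  ultimately have "p ^ (m + 1) dvd bit_form + p ^ (2 * (k + 1)) * lin (bits X) (bits Y) (bits Z) (bits W)"
    using coprime_dvd_mult_right_iff by blast
  moreover have "p ^ (m + 1) dvd p ^ (2 * (k + 1)) * lin (bits X) (bits Y) (bits Z) (bits W)"
    using assms(2) by (intro dvd_mult2 le_imp_power_dvd)
  ultimately show False
    using assms(1) by (simp only: dvd_add_left_iff)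
qed

text \<open>The linear equations express c (z - w) through p^k a (x - w) and p^l b (y - w) up to
  multiples of the base, and c is a unit.\<close>

lemma agree_z:
  assumes "agree i x w" "agree j y w" "n \<le> k + i" "n \<le> l + j" "n \<le> k + 1"
  shows "agree n z w"
proof -
  have *: "p ^ n dvd m\<^sub>z - m\<^sub>w"
    if "lin (m\<^sub>x + base * n\<^sub>x) (m\<^sub>y + base * n\<^sub>y) (m\<^sub>z + base * n\<^sub>z) (m\<^sub>w + base * n\<^sub>w) = 0"
      "p ^ i dvd m\<^sub>x - m\<^sub>w" "p ^ j dvd m\<^sub>y - m\<^sub>w" for m\<^sub>x m\<^sub>y m\<^sub>z m\<^sub>w n\<^sub>x n\<^sub>y n\<^sub>z n\<^sub>w
  proof -
    have "p ^ (k + i) dvd p ^ k * a * (m\<^sub>x - m\<^sub>w)" "p ^ (l + j) dvd p ^ l * b * (m\<^sub>y - m\<^sub>w)"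
      using that(2,3) by (simp_all add: power_add mult_dvd_mono)
    then have "p ^ n dvd p ^ k * a * (m\<^sub>x - m\<^sub>w)" "p ^ n dvd p ^ l * b * (m\<^sub>y - m\<^sub>w)"
      using assms(3,4) by (meson dvd_trans le_imp_power_dvd)+
    moreover have "p ^ n dvd base * lin n\<^sub>x n\<^sub>y n\<^sub>z n\<^sub>w"
      using pow_dvd_base[OF assms(5)] by (rule dvd_mult2)
    moreover have "c * (m\<^sub>z - m\<^sub>w) = - (p ^ k * a * (m\<^sub>x - m\<^sub>w) + p ^ l * b * (m\<^sub>y - m\<^sub>w) + base * lin n\<^sub>x n\<^sub>y n\<^sub>z n\<^sub>w)"
      using that(1) unfolding lin_add_mult lin_diff[of m\<^sub>x] by simp
    ultimately have "p ^ n dvd c * (m\<^sub>z - m\<^sub>w)"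
      by (simp only: dvd_minus_iff dvd_add)
    moreover have "coprime (p ^ n) c"
      using units(3) prime_p by (simp add: prime_imp_coprime)
    ultimately show ?thesis
      using coprime_dvd_mult_right_iff by blast
  qed
  show ?thesis
    using sol assms(1,2) unfolding row_solution_def coord_simps agree_def
    by (blast intro: *)
qed

lemma bit_form_diff:
  "bit_form = p ^ k * a * (snd (snd x) - snd (snd w)) + p ^ l * b * (snd (snd y) - snd (snd w))
     + c * (snd (snd z) - snd (snd w))"
  by (simp add: bit_form_def lin_diff)

lemma p_dvd_alpha: "p dvd p ^ k * a * m"
  using l_less_k by (simp add: dvd_power)

lemma bit_form_unit:
  assumes "l > 0" "snd (snd z) \<noteq> snd (snd w)"
  shows "\<not> p dvd bit_form"
proof -
  have "p dvd p ^ l * b * m" for m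
    using assms(1) by (simp add: dvd_power)
  moreover have "\<not> p dvd c * (snd (snd z) - snd (snd w))"
    using assms(2) units(3) alphabet_bit[OF alph(3)] alphabet_bit[OF alph(4)] by auto
  ultimately show ?thesis
    unfolding bit_form_diff using p_dvd_alpha by (simp only: dvd_add_right_iff dvd_add not_False_eq_True)
qed

text \<open>Modulo p^(l+1) the x term drops out. For l > 0 only the y term remains; for l = 0 the y
  and z terms have to be treated together.\<close>

lemma bit_form_l:
  assumes "l > 0 \<Longrightarrow> snd (snd z) = snd (snd w)"
  shows "p ^ l dvd bit_form"
    and "\<not> (snd (snd y) = snd (snd w) \<and> snd (snd z) = snd (snd w)) \<Longrightarrow> \<not> p ^ (l + 1) dvd bit_form"
proof -
  have pk: "p ^ (l + 1) dvd p ^ k * a * m" for m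
    using l_less_k by (intro dvd_mult2 le_imp_power_dvd) simp
  show "p ^ l dvd bit_form"
  proof (cases "l = 0")
    case False
    then show ?thesis
      using assms pk unfolding bit_form_diff
      by (auto simp: mult.assoc intro!: dvd_add dvd_trans[OF le_imp_power_dvd[of l "l+1" p] pk[unfolded mult.assoc]])
  qed simp
  assume ne: "\<not> (snd (snd y) = snd (snd w) \<and> snd (snd z) = snd (snd w))"
  have "\<not> p ^ (l + 1) dvd p ^ l * b * (snd (snd y) - snd (snd w)) + c * (snd (snd z) - snd (snd w))"
  proof (cases "l = 0")
    case False
    then have "snd (snd z) = snd (snd w)" "snd (snd y) \<noteq> snd (snd w)"
      using assms ne by auto
    then show ?thesis
      using alphabet_bit[OF alph(2)] alphabet_bit[OF alph(4)] units(2) p_pos by auto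
  next
    case True
    \<comment> \<open>Bits different from that of w all differ from it with the same sign, so the
      sum is b, c or b + c up to sign, and b + c is -d modulo p.\<close>
    have "b + c = - (p ^ k * a * 1 + d)"
      using sum_zero True by simp
    then have "\<not> p dvd b + c"
      using units(4) p_dvd_alpha[of 1] by (metis dvd_add_right_iff dvd_minus_iff)
    then have "\<not> p dvd b + c" "\<not> p dvd - b - c" "\<not> p dvd b" "\<not> p dvd c"
      using units by (auto simp: dvd_diff_commute[of p "- b" c] add.commute)
    then show ?thesis
      using True ne alphabet_bit[OF alph(2)] alphabet_bit[OF alph(3)] alphabet_bit[OF alph(4)] by auto
  qed
  then show "\<not> p ^ (l + 1) dvd bit_form"
    unfolding bit_form_diff using pk by (simp only: add.assoc dvd_add_right_iff not_False_eq_True)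
qed

lemma bit_form_k:
  assumes "snd (snd y) = snd (snd w)" "snd (snd z) = snd (snd w)"
  shows "p ^ k dvd bit_form"
    and "snd (snd x) \<noteq> snd (snd w) \<Longrightarrow> \<not> p ^ (k + 1) dvd bit_form"
  using assms alphabet_bit[OF alph(1)] alphabet_bit[OF alph(4)] units(1) p_pos
  by (auto simp: bit_form_diff)

text \<open>
  If the bits disagree, the valuation of \<open>bit_form\<close> is \<open>0\<close>, \<open>l\<close> or \<open>k\<close>. In the first two cases the digits
  of \<open>w\<close> are more divisible than those of \<open>x\<close> (or \<open>y\<close>), never the other way round; in the last case
  the bit of \<open>x\<close> is set and that of \<open>w\<close> is not.
\<close>
lemma row_unit_odd:
  assumes "l > 0" "odd k"
  defines "n \<equiv> l div 2 + 1"
  shows "zeros n x \<Longrightarrow> zeros n w"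
    and "snd (snd z) \<noteq> snd (snd w) \<Longrightarrow> zeros n w \<and> \<not> zeros n x"
proof -
  have l: "even l" "l \<ge> 2"
    using assms(1,2) odd_kl by auto
  have n: "n \<le> k + 1" "n \<le> l" "n \<le> k + l div 2"
    using l l_less_k by (auto simp: n_def elim!: evenE)
  show *: "zeros n w \<and> \<not> zeros n x" if "snd (snd z) \<noteq> snd (snd w)"
  proof -
    have nd: "\<not> p ^ (0 + 1) dvd bit_form"
      using bit_form_unit[OF assms(1) that] by simp
    have ag: "agree (l div 2) x w" "agree ((k + 1) div 2) y w"
      using agree_if_bit_form_dvd[of 0] l_less_k by auto
    \<comment> \<open>As k is odd, y already agrees to order (k + 1)/2, which is all that is asked
      of it; so the failure lies with x.\<close>
    have na: "\<not> agree n x w"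
      using not_agree_if_bit_form_not_dvd[OF nd, of n "(k + 1) div 2"] ag(2) n(1) assms(2)
      by (auto simp: n_def elim!: oddE)
    have "agree n z w"
      using agree_z[OF ag] n by simp
    \<comment> \<open>One of the two bits is set, so that letter has zero digits, and agreement
      carries this over to w.\<close>
    then have "zeros n w"
      using that alphabet_zeros[OF alph(3)] alphabet_zeros[OF alph(4)] agree_zeros_iff by metis
    with na show ?thesis
      using zeros_imp_agree by blast
  qed
  show "zeros n w" if "zeros n x"
  proof (cases "snd (snd z) = snd (snd w)")
    case True
    have "agree n x w"
      using agree_if_bit_form_dvd(1)[OF bit_form_l(1)] True n l_less_k by simp
    then show ?thesis
      using that agree_zeros_iff by blast
  qed (use * in blast)
qed

text \<open>For even k the valuation k + l has the parity of the y term, attained at order k/2, so y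
  takes over the role that x has for odd k.\<close>

lemma row_unit_even:
  assumes "l > 0" "even k"
  defines "n \<equiv> k div 2 + 1"
  shows "zeros n y \<Longrightarrow> zeros n w"
    and "snd (snd z) \<noteq> snd (snd w) \<Longrightarrow> zeros n w \<and> \<not> zeros n y"
proof -
  have l: "odd l"
    using assms(2) odd_kl by auto
  have n: "n \<le> k + 1" "n \<le> l + k div 2" "n \<le> k + (l + 1) div 2" "2 * n \<le> k + l + 1"
    using assms(1,2) l_less_k by (auto simp: n_def elim!: evenE)
  show *: "zeros n w \<and> \<not> zeros n y" if "snd (snd z) \<noteq> snd (snd w)"
  proof -
    have nd: "\<not> p ^ (0 + 1) dvd bit_form"
      using bit_form_unit[OF assms(1) that] by simp
    have ag: "agree ((l + 1) div 2) x w" "agree (k div 2) y w"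
      using agree_if_bit_form_dvd[of 0] l_less_k by auto
    have na: "\<not> agree n y w"
      using not_agree_if_bit_form_not_dvd[OF nd, of "(l + 1) div 2" n] ag(1) n(1) l l_less_k assms(2)
      by (auto simp: n_def elim!: oddE)
    have "agree n z w"
      using agree_z[OF ag] n by simp
    then have "zeros n w"
      using that alphabet_zeros[OF alph(3)] alphabet_zeros[OF alph(4)] agree_zeros_iff by metis
    with na show ?thesis
      using zeros_imp_agree by blast
  qed
  show "zeros n w" if "zeros n y"
  proof (cases "snd (snd z) = snd (snd w)")
    case True
    have "agree n y w"
      using agree_if_bit_form_dvd(2)[OF bit_form_l(1)] True n l_less_k by simp
    then show ?thesis
      using that agree_zeros_iff by blast
  qed (use * in blast)
qed

text \<open>A discrepancy of valuation l puts \<open>row_quat\<close> at valuation k + 2 l, that of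
  the x term at order l. So x agrees with w to order l but not l + 1, whereas y and z agree with w
  to order l + 1.\<close>

lemma row_l:
  assumes "l > 0 \<Longrightarrow> snd (snd z) = snd (snd w)"
  shows "zeros (l + 1) x \<Longrightarrow> zeros (l + 1) w"
    and "\<not> (snd (snd y) = snd (snd w) \<and> snd (snd z) = snd (snd w)) \<Longrightarrow>
      zeros (l + 1) w \<and> \<not> zeros (l + 1) x"
proof -
  define j where "j = (k + l + 1) div 2"
  have j: "2 * j = k + l + 1"
    using odd_kl by (simp add: j_def)
  show *: "zeros (l + 1) w \<and> \<not> zeros (l + 1) x"
    if ne: "\<not> (snd (snd y) = snd (snd w) \<and> snd (snd z) = snd (snd w))"
  proof -
    have ag: "agree l x w" "agree j y w"
      using agree_if_bit_form_dvd[OF bit_form_l(1)[OF assms]] j l_less_k by auto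
    have na: "\<not> agree (l + 1) x w"
      using not_agree_if_bit_form_not_dvd[OF bit_form_l(2)[OF assms ne], of "l + 1" j] ag(2) j l_less_k
      by auto
    have "agree (l + 1) z w"
      using agree_z[OF ag] j l_less_k by simp
    moreover have "agree (l + 1) y w"
      using ag(2) by (rule agree_mono) (use j l_less_k in simp)
    ultimately have "zeros (l + 1) w"
      using ne alphabet_zeros[OF alph(2)] alphabet_zeros[OF alph(3)] alphabet_zeros[OF alph(4)]
        agree_zeros_iff by metis
    with na show ?thesis
      using zeros_imp_agree by blast
  qed
  show "zeros (l + 1) w" if "zeros (l + 1) x"
  proof (cases "snd (snd y) = snd (snd w) \<and> snd (snd z) = snd (snd w)")
    case True
    have "agree (l + 1) x w"
      using agree_if_bit_form_dvd(1)[OF bit_form_k(1)] True l_less_k by simp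
    then show ?thesis
      using that agree_zeros_iff by blast
  qed (use * in blast)
qed

text \<open>A discrepancy of valuation k requires y and w to differ at order k + 1, but their set
  bits make both digit pairs zero. A set bit of x against an unset bit of w is left to the counting
  argument.\<close>

lemma row_k:
  assumes "snd (snd y) = snd (snd w)" "snd (snd z) = snd (snd w)" "snd (snd w) \<noteq> 0"
  shows "snd (snd x) = snd (snd w)"
proof (rule ccontr)
  assume ne: "snd (snd x) \<noteq> snd (snd w)"
  define i where "i = (k + l + 1) div 2"
  have i: "2 * i = k + l + 1"
    using odd_kl by (simp add: i_def)
  have "agree i x w"
    using agree_if_bit_form_dvd(1)[OF bit_form_k(1)[OF assms(1,2)]] i l_less_k by auto
  moreover have "agree (k + 1) y w"
    using assms alphabet_zeros[OF alph(2)] alphabet_zeros[OF alph(4)] zeros_imp_agree by metis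
  ultimately show False
    using not_agree_if_bit_form_not_dvd[OF bit_form_k(2)[OF assms(1,2) ne], of i "k + 1"] i l_less_k
    by auto
qed

text \<open>With equal bits \<open>bit_form\<close> is 0, so the digits agree to the full order k +
  1.\<close>

lemma row_heads_eq:
  assumes "snd (snd x) = snd (snd w)" "snd (snd y) = snd (snd w)" "snd (snd z) = snd (snd w)"
  shows "x = w \<and> y = w \<and> z = w"
proof -
  have "p ^ (2 * (k + 1)) dvd bit_form"
    by (simp add: bit_form_diff assms)
  note ag = agree_if_bit_form_dvd[OF this order_refl, of "k + 1"]
  have "agree (k + 1) x w" "agree (k + 1) y w"
    using ag by simp_all
  moreover from this have "agree (k + 1) z w"
    by (rule agree_z) simp_all
  ultimately show ?thesis
    using alphabet_agree_eq alph assms by metis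
qed

end

end

section \<open>Equidistributed families of points\<close>

text \<open>Equality of distributions under counting measure; quantifying over all predicates lets
  it pass to functions of the values.\<close>

definition same_law :: "'i set \<Rightarrow> ('i \<Rightarrow> 'a) \<Rightarrow> ('i \<Rightarrow> 'a) \<Rightarrow> bool" where
  "same_law I f g \<longleftrightarrow> (\<forall>S. card {i \<in> I. S (f i)} = card {i \<in> I. S (g i)})"

text \<open>This removes one-sided discrepancies: an inclusion between finite sets of equal size is
  an equality.\<close>

lemma same_lawD:
  assumes "finite I" "same_law I f g" "\<And>i. i \<in> I \<Longrightarrow> S (f i) \<Longrightarrow> S (g i)" "i \<in> I" "S (g i)"
  shows "S (f i)"
proof -
  have "{i \<in> I. S (f i)} = {i \<in> I. S (g i)}"
    using assms(1-3) by (intro card_subset_eq) (auto simp: same_law_def)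
  then show ?thesis
    using assms(4,5) by blast
qed

lemma same_law_comp: "same_law I f g \<Longrightarrow> same_law I (\<lambda>i. h (f i)) (\<lambda>i. h (g i))"
  unfolding same_law_def by (intro allI, drule_tac x = "\<lambda>x. S (h x)" in spec)

lemma same_law_bij_betw:
  assumes "bij_betw f I A" "bij_betw g I A"
  shows "same_law I f g"
proof -
  have "card {i \<in> I. S (f i)} = card {x \<in> A. S x}" if "bij_betw f I A" for f S
  proof (rule bij_betw_same_card)
    show "bij_betw f {i \<in> I. S (f i)} {x \<in> A. S x}"
      using that by (rule bij_betw_subset) (use that in \<open>auto simp: bij_betw_def\<close>)
  qed
  then show ?thesis
    using assms by (simp add: same_law_def)
qed

context ramified_form
begin

lemma row_solution_tail:
  assumes "row_solution (h # X) (h # Y) (h # Z) (h # W)"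
  shows "row_solution X Y Z W"
proof -
  have b: "base \<noteq> 0"
    using p_pos by (simp add: base_def)
  have 1: "lin (coord1 X) (coord1 Y) (coord1 Z) (coord1 W) = 0"
    and 2: "lin (coord2 X) (coord2 Y) (coord2 Z) (coord2 W) = 0"
    using assms b unfolding row_solution_def coord_simps lin_add_mult by simp_all
  have "c \<noteq> 0"
    using units(3) by auto
  have d: "(m + r * s) - (m + r * t) = r * (s - t)" for m r s t :: int
    by (simp add: algebra_simps)
  have sc: "quat (r * x\<^sub>1) (r * x\<^sub>2) (r * y\<^sub>1) (r * y\<^sub>2) = r\<^sup>2 * quat x\<^sub>1 x\<^sub>2 y\<^sub>1 y\<^sub>2" for r x\<^sub>1 x\<^sub>2 y\<^sub>1 y\<^sub>2
    by (simp add: quat_def qf_def polar_def power2_eq_square algebra_simps)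
  have q: "lin (qf (coord1 (h # X)) (coord2 (h # X))) (qf (coord1 (h # Y)) (coord2 (h # Y)))
      (qf (coord1 (h # Z)) (coord2 (h # Z))) (qf (coord1 (h # W)) (coord2 (h # W)))
    = base\<^sup>2 * lin (qf (coord1 X) (coord2 X)) (qf (coord1 Y) (coord2 Y)) (qf (coord1 Z) (coord2 Z))
      (qf (coord1 W) (coord2 W))" (is "?l = base\<^sup>2 * ?r")
  proof -
    \<comment> \<open>\<open>quat\<close> depends only on differences; the common letter cancels
      there and leaves multiples of the base.\<close>
    have "c * ?l = base\<^sup>2 * (c * ?r)"
      using assms unfolding row_solution_def
      by (simp only: lin_qf 1 2 coord_simps d sc simp_thms)
    then show ?thesis
      using \<open>c \<noteq> 0\<close> by simp
  qed
  have "0 = lin (height (h # X)) (height (h # Y)) (height (h # Z)) (height (h # W))"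
    using assms by (simp add: row_solution_def)
  also have "\<dots> = ?l + p ^ (k + l) * lin (bits (h # X)) (bits (h # Y)) (bits (h # Z)) (bits (h # W))"
    unfolding height_def lin_add_mult ..
  also have "\<dots> = base\<^sup>2 * lin (height X) (height Y) (height Z) (height W)"
    unfolding height_def lin_add_mult q[unfolded coord_simps] coord_simps by (simp add: algebra_simps)
  finally show ?thesis
    using b 1 2 by (simp add: row_solution_def)
qed

text \<open>The possible bit discrepancies are excluded in the order of their valuations 0, l, k,
  each time by comparing how often a one-sided property occurs in two columns.\<close>

lemma heads_equal:
  assumes I: "finite I"
    and sol: "\<And>i. i \<in> I \<Longrightarrow> row_solution (x i # X i) (y i # Y i) (z i # Z i) (w i # W i)"
    and alph: "\<And>i. i \<in> I \<Longrightarrow> x i \<in> alphabet" "\<And>i. i \<in> I \<Longrightarrow> y i \<in> alphabet"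
      "\<And>i. i \<in> I \<Longrightarrow> z i \<in> alphabet" "\<And>i. i \<in> I \<Longrightarrow> w i \<in> alphabet"
    and law: "same_law I x w" "same_law I y w"
    and i: "i \<in> I"
  shows "x i = w i \<and> y i = w i \<and> z i = w i"
proof -
  note row = sol alph
  have 1: "snd (snd (z i)) = snd (snd (w i))" if "l > 0" "i \<in> I" for i
  proof (cases "odd k")
    case True
    have R: "zeros (l div 2 + 1) (x i) \<Longrightarrow> zeros (l div 2 + 1) (w i)"
      "snd (snd (z i)) \<noteq> snd (snd (w i)) \<Longrightarrow> zeros (l div 2 + 1) (w i) \<and> \<not> zeros (l div 2 + 1) (x i)"
      if "i \<in> I" for i
      using row_unit_odd[OF row[OF that] \<open>l > 0\<close> \<open>odd k\<close>] by blast+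
    show ?thesis
      using same_lawD[OF I law(1), of "zeros (l div 2 + 1)" i] R that(2) by blast
  next
    case False
    then have "even k" by simp
    have R: "zeros (k div 2 + 1) (y i) \<Longrightarrow> zeros (k div 2 + 1) (w i)"
      "snd (snd (z i)) \<noteq> snd (snd (w i)) \<Longrightarrow> zeros (k div 2 + 1) (w i) \<and> \<not> zeros (k div 2 + 1) (y i)"
      if "i \<in> I" for i
      using row_unit_even[OF row[OF that] \<open>l > 0\<close> \<open>even k\<close>] by blast+
    show ?thesis
      using same_lawD[OF I law(2), of "zeros (k div 2 + 1)" i] R that(2) by blast
  qed
  have 2: "snd (snd (y i)) = snd (snd (w i)) \<and> snd (snd (z i)) = snd (snd (w i))" if "i \<in> I" for i
  proof -
    have R: "zeros (l + 1) (x i) \<Longrightarrow> zeros (l + 1) (w i)"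
      "\<not> (snd (snd (y i)) = snd (snd (w i)) \<and> snd (snd (z i)) = snd (snd (w i))) \<Longrightarrow>
        zeros (l + 1) (w i) \<and> \<not> zeros (l + 1) (x i)" if "i \<in> I" for i
      using row_l[OF row[OF that]] 1 that by blast+
    show ?thesis
      using same_lawD[OF I law(1), of "zeros (l + 1)" i] R that by blast
  qed
  \<comment> \<open>A set bit of w forces one of x; equal numbers of set bits give the
    converse.\<close>
  have 3: "snd (snd (x i)) = snd (snd (w i))" if "i \<in> I" for i
  proof (rule ccontr)
    assume ne: "snd (snd (x i)) \<noteq> snd (snd (w i))"
    have R: "snd (snd (x i)) = snd (snd (w i))" if "i \<in> I" "snd (snd (w i)) \<noteq> 0" for i
      using row_k[OF row[OF that(1)]] 2 that by blast
    have "same_law I w x"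
      using law(1) by (simp add: same_law_def)
    from same_lawD[OF I this, of "\<lambda>h. snd (snd h) \<noteq> 0" i] show False
      using R ne that by metis
  qed
  show ?thesis
    using row_heads_eq[OF row[OF i]] 2 3 i by blast
qed

text \<open>Induction from the lowest letter upwards. The hypothesis concerns the law of whole rows,
  so it is inherited by the tails.\<close>

lemma rows_equal:
  assumes "finite I"
    and "\<And>i. i \<in> I \<Longrightarrow> row_solution (X i) (Y i) (Z i) (W i)"
    and "\<And>i. i \<in> I \<Longrightarrow> set (X i) \<subseteq> alphabet \<and> set (Y i) \<subseteq> alphabet \<and> set (Z i) \<subseteq> alphabet \<and> set (W i) \<subseteq> alphabet"
    and "\<And>i. i \<in> I \<Longrightarrow> length (X i) = n \<and> length (Y i) = n \<and> length (Z i) = n \<and> length (W i) = n"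
    and "same_law I X W" "same_law I Y W" "i \<in> I"
  shows "X i = W i \<and> Y i = W i \<and> Z i = W i"
  using assms(2-7)
proof (induction n arbitrary: X Y Z W i)
  case 0
  then show ?case by (metis length_0_conv)
next
  case (Suc n)
  have ne: "X i \<noteq> [] \<and> Y i \<noteq> [] \<and> Z i \<noteq> [] \<and> W i \<noteq> []" if "i \<in> I" for i
    using Suc.prems(3)[OF that] by auto
  have sol: "row_solution (hd (X i) # tl (X i)) (hd (Y i) # tl (Y i)) (hd (Z i) # tl (Z i)) (hd (W i) # tl (W i))"
    if "i \<in> I" for i
    using Suc.prems(1)[OF that] ne[OF that] by simp
  have heads: "hd (X i) = hd (W i) \<and> hd (Y i) = hd (W i) \<and> hd (Z i) = hd (W i)" if "i \<in> I" for i
  proof (rule heads_equal[OF assms(1) sol _ _ _ _ _ _ that])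
    fix i assume i: "i \<in> I"
    show "hd (X i) \<in> alphabet" "hd (Y i) \<in> alphabet" "hd (Z i) \<in> alphabet" "hd (W i) \<in> alphabet"
      using Suc.prems(2)[OF i] ne[OF i] list.set_sel(1) by blast+
  qed (use same_law_comp[OF Suc.prems(4)] same_law_comp[OF Suc.prems(5)] in blast)+
  have tl: "set (tl V) \<subseteq> set V" for V :: "(int \<times> int \<times> int) list"
    by (cases V) auto
  have "tl (X i) = tl (W i) \<and> tl (Y i) = tl (W i) \<and> tl (Z i) = tl (W i)"
  proof (rule Suc.IH)
    fix i assume i: "i \<in> I"
    show "row_solution (tl (X i)) (tl (Y i)) (tl (Z i)) (tl (W i))"
      by (rule row_solution_tail[of "hd (W i)"]) (use sol[OF i] heads[OF i] in simp)
    show "set (tl (X i)) \<subseteq> alphabet \<and> set (tl (Y i)) \<subseteq> alphabet \<and> set (tl (Z i)) \<subseteq> alphabet \<and> set (tl (W i)) \<subseteq> alphabet"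
      using Suc.prems(2)[OF i] tl by (meson subset_trans)
    show "length (tl (X i)) = n \<and> length (tl (Y i)) = n \<and> length (tl (Z i)) = n \<and> length (tl (W i)) = n"
      using Suc.prems(3)[OF i] by simp
  qed (use Suc.prems same_law_comp[OF Suc.prems(4), of tl] same_law_comp[OF Suc.prems(5), of tl] in auto)
  then show ?case
    using heads[OF Suc.prems(6)] ne[OF Suc.prems(6)] by (metis list.expand)
qed

end

section \<open>Encoding as integers and counting\<close>

text \<open>Stronger than being free: all four entries must coincide.\<close>

definition only_trivial :: "int \<Rightarrow> int \<Rightarrow> int \<Rightarrow> int \<Rightarrow> int set \<Rightarrow> bool" where
  "only_trivial \<alpha> \<beta> \<gamma> \<delta> A \<longleftrightarrow> (\<forall>x\<in>A. \<forall>y\<in>A. \<forall>z\<in>A. \<forall>w\<in>A.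
     \<alpha> * x + \<beta> * y + \<gamma> * z + \<delta> * w = 0 \<longrightarrow> x = w \<and> y = w \<and> z = w)"

lemma form_bound:
  fixes \<alpha> \<beta> \<gamma> \<delta> D M :: int
  assumes "\<bar>\<alpha>\<bar> + \<bar>\<beta>\<bar> + \<bar>\<gamma>\<bar> + \<bar>\<delta>\<bar> \<le> D" "D > 0"
    and "x \<in> {0..<M}" "y \<in> {0..<M}" "z \<in> {0..<M}" "w \<in> {0..<M}"
  shows "\<bar>\<alpha> * x + \<beta> * y + \<gamma> * z + \<delta> * w\<bar> < D * M"
proof -
  have *: "\<bar>e * t\<bar> \<le> \<bar>e\<bar> * (M - 1)" if "t \<in> {0..<M}" for e t
    using that by (auto simp: abs_mult intro!: mult_left_mono)
  have "\<bar>\<alpha> * x + \<beta> * y + \<gamma> * z + \<delta> * w\<bar> \<le> \<bar>\<alpha> * x\<bar> + \<bar>\<beta> * y\<bar> + \<bar>\<gamma> * z\<bar> + \<bar>\<delta> * w\<bar>"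
    by linarith
  also have "\<dots> \<le> \<bar>\<alpha>\<bar> * (M - 1) + \<bar>\<beta>\<bar> * (M - 1) + \<bar>\<gamma>\<bar> * (M - 1) + \<bar>\<delta>\<bar> * (M - 1)"
    using * assms(3-6) by (intro add_mono) auto
  also have "\<dots> = (\<bar>\<alpha>\<bar> + \<bar>\<beta>\<bar> + \<bar>\<gamma>\<bar> + \<bar>\<delta>\<bar>) * (M - 1)"
    by (simp add: algebra_simps)
  also have "\<dots> \<le> D * (M - 1)"
    using assms by (intro mult_right_mono) auto
  also have "\<dots> < D * M"
    using assms(2) by simp
  finally show ?thesis .
qed

lemma no_carry_step:
  fixes e f g :: int
  assumes "e + g * f = 0" "\<bar>e\<bar> < g"
  shows "e = 0 \<and> f = 0"
proof -
  have "e = g * (- f)"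
    using assms(1) by simp
  then have "g dvd e"
    by (rule dvdI)
  then have "e = 0"
    using assms(2) dvd_imp_le_int[of e g] by linarith
  then show ?thesis
    using assms by auto
qed

text \<open>D bounds the sum of the absolute coefficients, so the form at digits below M stays below
  D M in absolute value, and the equation splits digit by digit.\<close>

lemma horner_sum_no_carry:
  fixes \<alpha> \<beta> \<gamma> \<delta> D M :: int
  assumes "\<bar>\<alpha>\<bar> + \<bar>\<beta>\<bar> + \<bar>\<gamma>\<bar> + \<bar>\<delta>\<bar> \<le> D" "D > 0"
    and "length xs = length ys" "length ys = length zs" "length zs = length ws"
    and "f ` (set xs \<union> set ys \<union> set zs \<union> set ws) \<subseteq> {0..<M}"
    and "\<alpha> * horner_sum f (D * M) xs + \<beta> * horner_sum f (D * M) ys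
      + \<gamma> * horner_sum f (D * M) zs + \<delta> * horner_sum f (D * M) ws = 0"
    and "i < length xs"
  shows "\<alpha> * f (xs ! i) + \<beta> * f (ys ! i) + \<gamma> * f (zs ! i) + \<delta> * f (ws ! i) = 0"
  using assms(3-8)
proof (induction xs ys zs ws arbitrary: i rule: list_induct4)
  case (Cons x xs y ys z zs w ws)
  let ?h = "horner_sum f (D * M)"
  have "(\<alpha> * f x + \<beta> * f y + \<gamma> * f z + \<delta> * f w)
    + (D * M) * (\<alpha> * ?h xs + \<beta> * ?h ys + \<gamma> * ?h zs + \<delta> * ?h ws) = 0"
    using Cons.prems(2) by (simp add: algebra_simps)
  moreover have "\<bar>\<alpha> * f x + \<beta> * f y + \<gamma> * f z + \<delta> * f w\<bar> < D * M"
    using Cons.prems(1) by (intro form_bound assms) auto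
  ultimately have "\<alpha> * f x + \<beta> * f y + \<gamma> * f z + \<delta> * f w = 0"
    "\<alpha> * ?h xs + \<beta> * ?h ys + \<gamma> * ?h zs + \<delta> * ?h ws = 0"
    using no_carry_step by blast+
  then show ?case
    using Cons.prems(1,3) Cons.IH by (cases i) auto
qed simp

lemma horner_sum_in_range:
  fixes g :: int
  assumes "f ` set xs \<subseteq> {0..<g}" "g > 0"
  shows "horner_sum f g xs \<in> {0..<g ^ length xs}"
  using assms(1)
proof (induction xs)
  case (Cons x xs)
  then have "horner_sum f g xs \<le> g ^ length xs - 1" "0 \<le> horner_sum f g xs" "f x \<in> {0..<g}"
    by auto
  moreover from this have "g * horner_sum f g xs \<le> g * (g ^ length xs - 1)"
    using assms(2) by (intro mult_left_mono) auto
  ultimately show ?case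
    using assms(2) by (auto simp: algebra_simps)
qed simp

lemma inj_on_if_only_trivial:
  fixes h :: "'a \<Rightarrow> int"
  assumes "\<alpha> + \<beta> + \<gamma> + \<delta> = 0"
    and "\<And>x y z w. x \<in> A \<Longrightarrow> y \<in> A \<Longrightarrow> z \<in> A \<Longrightarrow> w \<in> A \<Longrightarrow>
      \<alpha> * h x + \<beta> * h y + \<gamma> * h z + \<delta> * h w = 0 \<Longrightarrow> x = w \<and> y = w \<and> z = w"
  shows "inj_on h A" "only_trivial \<alpha> \<beta> \<gamma> \<delta> (h ` A)"
proof -
  show "inj_on h A"
  proof (rule inj_onI)
    fix x w assume xw: "x \<in> A" "w \<in> A" "h x = h w"
    \<comment> \<open>A collision of x and w yields the solution (x, w, w, w), because the
      coefficients sum to zero.\<close>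
    have "\<alpha> * h x + \<beta> * h w + \<gamma> * h w + \<delta> * h w = (\<alpha> + \<beta> + \<gamma> + \<delta>) * h w"
      using xw(3) by (simp add: algebra_simps)
    then show "x = w"
      using assms xw by simp
  qed
  show "only_trivial \<alpha> \<beta> \<gamma> \<delta> (h ` A)"
    using assms(2) unfolding only_trivial_def by blast
qed

text \<open>n^n / n! is one term of the exponential series of e^n, and e is at most 3.\<close>

lemma power_self_le_fact: "real n ^ n \<le> 3 ^ n * fact n"
proof -
  have "real n ^ n / fact n \<le> exp (real n)"
  proof -
    have "(\<Sum>i\<in>{n}. inverse (fact i) * real n ^ i) \<le> (\<Sum>i. inverse (fact i) * real n ^ i)"
      by (rule sum_le_suminf) (auto intro: summable_exp)
    then show ?thesis
      by (simp add: exp_def divide_inverse mult.commute scaleR_conv_of_real)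
  qed
  also have "\<dots> = exp 1 ^ n"
    by (simp add: exp_of_nat_mult[symmetric])
  also have "\<dots> \<le> 3 ^ n"
    using exp_le by (intro power_mono) auto
  finally show ?thesis
    by (simp add: field_simps)
qed

lemma exists_power_ratio_gt:
  fixes r s K :: real
  assumes "0 < s" "s < r"
  obtains n where "K * s ^ n < r ^ n"
proof -
  obtain n where "K < (r / s) ^ n"
    using real_arch_pow[of "r / s" K] assms by auto
  then have "K * s ^ n < (r / s) ^ n * s ^ n"
    using assms by simp
  then show ?thesis
    using that assms by (simp add: power_divide)
qed

section \<open>Packing rows into integers and counting orderings\<close>

context ramified_form
begin

definition height_const :: int where
  "height_const = 1 + u + v + p ^ (k + l)"

text \<open>The height is the top digit, the only one allowed to exceed the range of the
  coordinates.\<close>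

definition row_code :: "int \<Rightarrow> nat \<Rightarrow> (int \<times> int \<times> int) list \<Rightarrow> int" where
  "row_code D n X = coord1 X + (D * base ^ n) * (coord2 X + (D * base ^ n) * height X)"

lemma base_gt_1: "base > 1"
  unfolding base_def using p_ge_2 by (intro one_less_power) auto

lemma coords_in_range:
  assumes "set X \<subseteq> alphabet" "length X = n"
  shows "coord1 X \<in> {0..<base ^ n}" "coord2 X \<in> {0..<base ^ n}"
    "height X \<in> {0..<height_const * base ^ (2 * n)}"
proof -
  have b: "base > 0" "base\<^sup>2 > 1"
    using base_gt_1 by (auto simp: power2_eq_square less_1_mult)
  have "fst h \<in> {0..<base} \<and> fst (snd h) \<in> {0..<base}" if "h \<in> alphabet" for h
    using that b by (auto simp: alphabet_def)
  then have "fst ` set X \<subseteq> {0..<base}" "(\<lambda>h. fst (snd h)) ` set X \<subseteq> {0..<base}"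
    using assms(1) by blast+
  then show 1: "coord1 X \<in> {0..<base ^ n}" and 2: "coord2 X \<in> {0..<base ^ n}"
    using horner_sum_in_range[of fst X base] horner_sum_in_range[of "\<lambda>h. fst (snd h)" X base] b(1)
    unfolding coord1_def coord2_def assms(2)[symmetric] by blast+
  have 3: "bits X \<in> {0..<(base\<^sup>2) ^ n}"
    using assms b horner_sum_in_range[of "\<lambda>h. snd (snd h)" X "base\<^sup>2"] alphabet_bit
    by (force simp: bits_def)
  have B: "base ^ (2 * n) = base ^ n * base ^ n" "(base\<^sup>2) ^ n = base ^ n * base ^ n"
    by (simp_all add: power2_eq_square power_mult_distrib mult_2 power_add)
  have m: "s * t \<le> base ^ n * base ^ n" "0 \<le> s * t" if "s \<in> {0..<base ^ n}" "t \<in> {0..<base ^ n}" for s t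
    using that by (auto intro: mult_mono)
  have "qf (coord1 X) (coord2 X) = coord1 X * coord1 X + u * (coord1 X * coord2 X) + v * (coord2 X * coord2 X)"
    by (simp add: qf_def power2_eq_square)
  also have "\<dots> \<le> base ^ n * base ^ n + u * (base ^ n * base ^ n) + v * (base ^ n * base ^ n)"
    using m 1 2 form_nonneg by (intro add_mono mult_left_mono) auto
  finally have "qf (coord1 X) (coord2 X) \<le> (1 + u + v) * (base ^ n * base ^ n)"
    by (simp add: algebra_simps)
  moreover have "p ^ (k + l) * bits X < p ^ (k + l) * (base ^ n * base ^ n)"
    using 3 p_pos B by simp
  moreover have "0 \<le> qf (coord1 X) (coord2 X)"
    using m 1 2 form_nonneg by (auto simp: qf_def power2_eq_square mult.assoc)
  moreover have "0 \<le> p ^ (k + l) * bits X"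
    using 3 p_pos by simp
  ultimately show "height X \<in> {0..<height_const * base ^ (2 * n)}"
    unfolding height_def height_const_def B by (simp add: distrib_right)
qed

lemma row_code_in_range:
  assumes "set X \<subseteq> alphabet" "length X = n" "D > 0"
  shows "row_code D n X \<in> {0..<D\<^sup>2 * height_const * base ^ (4 * n)}"
proof -
  define g where "g = D * base ^ n"
  have g: "base ^ n \<le> g" "0 < g"
    using assms(3) base_gt_1 by (auto simp: g_def)
  have g2: "D\<^sup>2 * height_const * base ^ (4 * n) = g * (g * (height_const * base ^ (2 * n)))"
    by (simp add: g_def power2_eq_square power_add[symmetric] mult_2[symmetric] algebra_simps flip: power_add)
  note R = coords_in_range[OF assms(1,2)]
  have "coord2 X + g * height X \<le> (g - 1) + g * (height_const * base ^ (2 * n) - 1)"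
    using R g by (intro add_mono mult_left_mono) auto
  also have "\<dots> = g * (height_const * base ^ (2 * n)) - 1"
    by (simp add: algebra_simps)
  finally have "g * (coord2 X + g * height X) \<le> g * (g * (height_const * base ^ (2 * n)) - 1)"
    using g by (intro mult_left_mono) auto
  moreover have "coord1 X \<le> g - 1"
    using R g by auto
  ultimately have "row_code D n X < g * (g * (height_const * base ^ (2 * n)))"
    unfolding row_code_def g_def[symmetric] by (simp add: algebra_simps)
  moreover have "0 \<le> row_code D n X"
    unfolding row_code_def g_def[symmetric] using R g by auto
  ultimately show ?thesis
    by (simp add: g2)
qed

lemma row_code_solution:
  assumes D: "\<bar>p ^ k * a\<bar> + \<bar>p ^ l * b\<bar> + \<bar>c\<bar> + \<bar>d\<bar> \<le> D" "D > 0"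
    and "\<And>V. V \<in> {X, Y, Z, W} \<Longrightarrow> set V \<subseteq> alphabet \<and> length V = n"
    and "lin (row_code D n X) (row_code D n Y) (row_code D n Z) (row_code D n W) = 0"
  shows "row_solution X Y Z W"
proof -
  let ?g = "D * base ^ n"
  have R: "coord1 V \<in> {0..<base ^ n}" "coord2 V \<in> {0..<base ^ n}" if "V \<in> {X, Y, Z, W}" for V
    using coords_in_range assms(3)[OF that] by blast+
  have bd: "\<bar>lin (coord1 X) (coord1 Y) (coord1 Z) (coord1 W)\<bar> < ?g"
    "\<bar>lin (coord2 X) (coord2 Y) (coord2 Z) (coord2 W)\<bar> < ?g"
    unfolding lin_def using R by (intro form_bound[OF D]; simp)+
  from no_carry_step[OF assms(4)[unfolded row_code_def lin_add_mult] bd(1)]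
  have 1: "lin (coord1 X) (coord1 Y) (coord1 Z) (coord1 W) = 0"
    and 2: "lin (coord2 X) (coord2 Y) (coord2 Z) (coord2 W) + ?g * lin (height X) (height Y) (height Z) (height W) = 0"
    by blast+
  show ?thesis
    using 1 no_carry_step[OF 2 bd(2)] by (simp add: row_solution_def)
qed

definition rows :: "nat \<Rightarrow> (int \<times> int \<times> int) list set" where
  "rows n = {X. set X \<subseteq> alphabet \<and> length X = n}"

lemma rows_finite_card: "finite (rows n)" "real (card (rows n)) = (real_of_int base ^ 2 + 1) ^ n"
proof -
  have fin: "finite alphabet"
    by (simp add: alphabet_def)
  then show "finite (rows n)"
    by (simp add: rows_def finite_lists_length_eq)
  have "card alphabet = card ({0..<base} \<times> {0..<base} \<times> {0::int}) + card {(0::int, 0::int, 1::int)}"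
    unfolding alphabet_def by (intro card_Un_disjoint) auto
  then have "real (card alphabet) = real_of_int base ^ 2 + 1"
    using base_gt_1 by (simp add: card_cartesian_product power2_eq_square)
  then show "real (card (rows n)) = (real_of_int base ^ 2 + 1) ^ n"
    by (simp add: rows_def card_lists_length_eq[OF fin])
qed

text \<open>The spare factor D pays for the carry-free base D M when powers of the set are formed
  later.\<close>

lemma exists_large_only_trivial:
  assumes D: "\<bar>p ^ k * a\<bar> + \<bar>p ^ l * b\<bar> + \<bar>c\<bar> + \<bar>d\<bar> \<le> D" "D > 0"
  shows "\<exists>A M. finite A \<and> 0 < M \<and> A \<subseteq> {0..<M} \<and> only_trivial (p ^ k * a) (p ^ l * b) c d A
    \<and> D * M < int (card A) ^ 2"
proof -
  \<comment> \<open>Chosen so that the inequality for n reads 9 D^2 M < N^2, with N the number of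
    rows and M the range of their codes: 9 is the square of the 3 in the factorial bound, one D
    makes the base carry-free, and the other pays for the spare factor.\<close>
  define K where "K = 9 * real_of_int (D ^ 4 * height_const)"
  have hc: "height_const \<ge> 1"
    using form_nonneg p_pos by (simp add: height_const_def)
  obtain n where n: "K * (real_of_int base ^ 4) ^ n < ((real_of_int base ^ 2 + 1) ^ 2) ^ n"
  proof (rule exists_power_ratio_gt)
    show "0 < real_of_int base ^ 4"
      using base_gt_1 by simp
    show "real_of_int base ^ 4 < (real_of_int base ^ 2 + 1) ^ 2"
      by (simp add: power2_eq_square algebra_simps power4_eq_xxxx add_pos_nonneg)
  qed
  define M where "M = D\<^sup>2 * height_const * base ^ (4 * n)"
  define N where "N = card (rows n)"
  define code where "code = horner_sum (row_code D n) (D * M)"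
  \<comment> \<open>Every ordering enumerates the same set of rows, so any two orderings have the
    same law.\<close>
  define P where "P = permutations_of_set (rows n)"
  have set_P: "set xs = rows n" "distinct xs" if "xs \<in> P" for xs
    using that by (simp_all add: P_def permutations_of_set_def)
  have len: "length xs = N" if "xs \<in> P" for xs
    using set_P[OF that] distinct_card[of xs] by (simp add: N_def)
  have M: "M > 0"
    using D(2) hc base_gt_1 by (simp add: M_def)
  have rng: "row_code D n ` set xs \<subseteq> {0..<M}" if "xs \<in> P" for xs
    using row_code_in_range[OF _ _ D(2)] set_P(1)[OF that] unfolding M_def rows_def by blast
  have triv: "xs = ws \<and> ys = ws \<and> zs = ws"
    if P: "xs \<in> P" "ys \<in> P" "zs \<in> P" "ws \<in> P"
      and eq: "p ^ k * a * code xs + p ^ l * b * code ys + c * code zs + d * code ws = 0"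
    for xs ys zs ws
  proof -
    have mem: "V ! i \<in> rows n" if "V \<in> P" "i < N" for V i
      using nth_mem[of i V] that len[OF that(1)] set_P(1)[OF that(1)] by simp
    have bij: "bij_betw ((!) V) {..<N} (rows n)" if "V \<in> P" for V
      using bij_betw_nth[of V "{..<N}" "rows n"] len[OF that] set_P[OF that] by simp
    have sol: "row_solution (xs ! i) (ys ! i) (zs ! i) (ws ! i)" if "i < N" for i
    proof (rule row_code_solution[OF D])
      show "set V \<subseteq> alphabet \<and> length V = n" if "V \<in> {xs ! i, ys ! i, zs ! i, ws ! i}" for V
        using that mem[OF _ \<open>i < N\<close>] P by (auto simp: rows_def)
      show "lin (row_code D n (xs ! i)) (row_code D n (ys ! i)) (row_code D n (zs ! i)) (row_code D n (ws ! i)) = 0"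
        unfolding lin_def
        by (rule horner_sum_no_carry[OF D, where M = M]) (use P rng len that eq in \<open>auto simp: code_def image_Un\<close>)
    qed
    have "xs ! i = ws ! i \<and> ys ! i = ws ! i \<and> zs ! i = ws ! i" if "i < N" for i
    proof (rule rows_equal[of "{..<N}" "(!) xs" "(!) ys" "(!) zs" "(!) ws" n])
      show "same_law {..<N} ((!) xs) ((!) ws)" "same_law {..<N} ((!) ys) ((!) ws)"
        using bij P same_law_bij_betw by blast+
    qed (use sol mem P that in \<open>auto simp: rows_def\<close>)
    then show ?thesis
      using len P by (auto intro!: nth_equalityI)
  qed
  have P_fin: "finite P" and P_card: "card P = fact N"
    using rows_finite_card(1) by (simp_all add: P_def N_def)
  note inj = inj_on_if_only_trivial[of "p ^ k * a" "p ^ l * b" c d P code, OF sum_zero triv]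
  have "code ` P \<subseteq> {0..<(D * M) ^ N}"
  proof -
    have "M \<le> D * M"
      using D(2) M by simp
    then have "row_code D n ` set xs \<subseteq> {0..<D * M}" if "xs \<in> P" for xs
      using rng[OF that] by (meson atLeastLessThan_iff order_less_le_trans subset_iff)
    then have "code xs \<in> {0..<(D * M) ^ N}" if "xs \<in> P" for xs
      using horner_sum_in_range[of "row_code D n" xs "D * M"] len[OF that] D(2) M that
      by (simp add: code_def)
    then show ?thesis
      by blast
  qed
  moreover have "D * (D * M) ^ N < int (card (code ` P)) ^ 2"
  proof -
    have rN: "real N = (real_of_int base ^ 2 + 1) ^ n"
      by (simp add: N_def rows_finite_card)
    have "0 < real N"
      unfolding rN by (intro zero_less_power add_nonneg_pos) auto
    then have N1: "N \<ge> 1"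
      by simp
    have "real_of_int (D * (D * M) ^ N) * 9 ^ N \<le> real_of_int (D ^ N * (D * M) ^ N) * 9 ^ N"
      using D(2) M N1 self_le_power[of D N] by (intro mult_right_mono) (auto intro: mult_right_mono)
    also have "\<dots> = (K * (real_of_int base ^ 4) ^ n) ^ N"
    proof -
      have "real_of_int (D * (D * M)) * 9 = K * (real_of_int base ^ 4) ^ n"
        by (simp add: K_def M_def power_mult power2_eq_square power4_eq_xxxx)
      then show ?thesis
        by (metis of_int_power power_mult_distrib)
    qed
    also have "\<dots> < (real N ^ 2) ^ N"
    proof (rule power_strict_mono)
      show "K * (real_of_int base ^ 4) ^ n < real N ^ 2"
        using n by (simp add: rN power_mult[symmetric] mult.commute)
    qed (use D(2) hc base_gt_1 N1 in \<open>auto simp: K_def\<close>)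
    also have "\<dots> = (real N ^ N)\<^sup>2"
      by (simp add: power_mult[symmetric] mult.commute)
    also have "\<dots> \<le> (3 ^ N * fact N)\<^sup>2"
      by (intro power_mono power_self_le_fact) auto
    also have "\<dots> = (fact N)\<^sup>2 * 9 ^ N"
    proof -
      have "(3 ^ N)\<^sup>2 = (9::real) ^ N"
        by (simp add: power2_eq_square flip: power_mult_distrib)
      then show ?thesis
        by (simp add: power_mult_distrib)
    qed
    finally have "real_of_int (D * (D * M) ^ N) < (fact N)\<^sup>2"
      by simp
    also have "(fact N)\<^sup>2 = real_of_int (int (fact N) ^ 2)"
      by simp
    finally show ?thesis
      by (simp only: of_int_less_iff card_image[OF inj(1)] P_card)
  qed
  moreover have "0 < (D * M) ^ N"
    using D(2) M by simp
  ultimately show ?thesis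
    using inj(2) P_fin by blast
qed

end

section \<open>The lower bound\<close>

text \<open>Insertion sort by adjacent transpositions.\<close>

lemma wlog_sorted4:
  fixes f :: "'a \<Rightarrow> nat"
  assumes sorted: "\<And>a b c d. f d \<le> f c \<Longrightarrow> f c \<le> f b \<Longrightarrow> f b \<le> f a \<Longrightarrow> P a b c d"
    and swap: "\<And>a b c d. P a b c d \<Longrightarrow> P b a c d" "\<And>a b c d. P a b c d \<Longrightarrow> P a c b d"
      "\<And>a b c d. P a b c d \<Longrightarrow> P a b d c"
  shows "P a b c d"
proof -
  have insert_last: "P a b c d" if "f c \<le> f b" "f b \<le> f a" for a b c d
  proof -
    consider "f d \<le> f c" | "f c \<le> f d" "f d \<le> f b" | "f b \<le> f d" "f d \<le> f a" | "f a \<le> f d"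
      by linarith
    then show ?thesis
    proof cases
      case 1
      then show ?thesis using that by (intro sorted)
    next
      case 2
      then show ?thesis using that by (intro swap(3)[OF sorted])
    next
      case 3
      then show ?thesis using that by (intro swap(3)[OF swap(2)[OF sorted]])
    next
      case 4
      then show ?thesis using that by (intro swap(3)[OF swap(2)[OF swap(1)[OF sorted]]])
    qed
  qed
  have 2: "P a b c d" if "f b \<le> f a" for a b c d
  proof -
    consider "f c \<le> f b" | "f b \<le> f c" "f c \<le> f a" | "f a \<le> f c"
      by linarith
    then show ?thesis
    proof cases
      case 1
      then show ?thesis using that by (intro insert_last)
    next
      case 2
      then show ?thesis using that by (intro swap(2)[OF insert_last])
    next
      case 3
      then show ?thesis using that by (intro swap(2)[OF swap(1)[OF insert_last]])
    qed
  qed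
  show ?thesis
    by (cases "f b \<le> f a") (auto intro: 2 swap(1)[OF 2])
qed

lemma only_trivial_swap:
  assumes "only_trivial \<alpha> \<beta> \<gamma> \<delta> A"
  shows "only_trivial \<beta> \<alpha> \<gamma> \<delta> A" "only_trivial \<alpha> \<gamma> \<beta> \<delta> A" "only_trivial \<alpha> \<beta> \<delta> \<gamma> A"
proof -
  have H: "x = w \<and> y = w \<and> z = w"
    if "x \<in> A" "y \<in> A" "z \<in> A" "w \<in> A" "\<alpha> * x + \<beta> * y + \<gamma> * z + \<delta> * w = 0" for x y z w
    using that assms unfolding only_trivial_def by blast
  show "only_trivial \<beta> \<alpha> \<gamma> \<delta> A"
    unfolding only_trivial_def
  proof (intro ballI impI)
    fix x y z w assume "x \<in> A" "y \<in> A" "z \<in> A" "w \<in> A" "\<beta> * x + \<alpha> * y + \<gamma> * z + \<delta> * w = 0"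
    then show "x = w \<and> y = w \<and> z = w"
      using H[of y x z w] by simp
  qed
  show "only_trivial \<alpha> \<gamma> \<beta> \<delta> A"
    unfolding only_trivial_def
  proof (intro ballI impI)
    fix x y z w assume "x \<in> A" "y \<in> A" "z \<in> A" "w \<in> A" "\<alpha> * x + \<gamma> * y + \<beta> * z + \<delta> * w = 0"
    then show "x = w \<and> y = w \<and> z = w"
      using H[of x z y w] by simp
  qed
  show "only_trivial \<alpha> \<beta> \<delta> \<gamma> A"
    unfolding only_trivial_def
  proof (intro ballI impI)
    fix x y z w assume "x \<in> A" "y \<in> A" "z \<in> A" "w \<in> A" "\<alpha> * x + \<beta> * y + \<delta> * z + \<gamma> * w = 0"
    then show "x = w \<and> y = w \<and> z = w"
      using H[of x y w z] by simp
  qed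
qed

lemma exists_large_only_trivial_of_odd_multiplicity:
  fixes p \<alpha> \<beta> \<gamma> \<delta> D :: int
  assumes p: "prime p" and nz: "\<alpha> \<noteq> 0" "\<beta> \<noteq> 0" "\<gamma> \<noteq> 0" "\<delta> \<noteq> 0"
    and sum: "\<alpha> + \<beta> + \<gamma> + \<delta> = 0"
    and odd: "odd (multiplicity p \<alpha> + multiplicity p \<beta> + multiplicity p \<gamma> + multiplicity p \<delta>)"
    and D: "\<bar>\<alpha>\<bar> + \<bar>\<beta>\<bar> + \<bar>\<gamma>\<bar> + \<bar>\<delta>\<bar> \<le> D"
  shows "\<exists>A M. finite A \<and> 0 < M \<and> A \<subseteq> {0..<M} \<and> only_trivial \<alpha> \<beta> \<gamma> \<delta> A \<and> D * M < int (card A) ^ 2"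
proof -
  let ?v = "multiplicity p"
  \<comment> \<open>Hypotheses and conclusion are packaged as predicates invariant under the three
    adjacent swaps.\<close>
  define R where "R = (\<lambda>\<alpha> \<beta> \<gamma> \<delta>. \<alpha> \<noteq> 0 \<and> \<beta> \<noteq> 0 \<and> \<gamma> \<noteq> 0 \<and> \<delta> \<noteq> 0 \<and>
    \<alpha> + \<beta> + \<gamma> + \<delta> = 0 \<and> odd (?v \<alpha> + ?v \<beta> + ?v \<gamma> + ?v \<delta>) \<and> \<bar>\<alpha>\<bar> + \<bar>\<beta>\<bar> + \<bar>\<gamma>\<bar> + \<bar>\<delta>\<bar> \<le> D)"
  define E where "E = (\<lambda>\<alpha> \<beta> \<gamma> \<delta>. \<exists>A M. finite A \<and> 0 < M \<and> A \<subseteq> {0..<M} \<and>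
    only_trivial \<alpha> \<beta> \<gamma> \<delta> A \<and> D * M < int (card A) ^ 2)"
  have "R \<alpha> \<beta> \<gamma> \<delta> \<longrightarrow> E \<alpha> \<beta> \<gamma> \<delta>"
  proof (rule wlog_sorted4[where f = ?v and P = "\<lambda>\<alpha> \<beta> \<gamma> \<delta>. R \<alpha> \<beta> \<gamma> \<delta> \<longrightarrow> E \<alpha> \<beta> \<gamma> \<delta>"])
    fix \<alpha> \<beta> \<gamma> \<delta> :: int
    assume v: "?v \<delta> \<le> ?v \<gamma>" "?v \<gamma> \<le> ?v \<beta>" "?v \<beta> \<le> ?v \<alpha>"
    show "R \<alpha> \<beta> \<gamma> \<delta> \<longrightarrow> E \<alpha> \<beta> \<gamma> \<delta>"
    proof
      assume "R \<alpha> \<beta> \<gamma> \<delta>"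
      then have nz: "\<alpha> \<noteq> 0" "\<beta> \<noteq> 0" "\<gamma> \<noteq> 0" "\<delta> \<noteq> 0" and sum: "\<alpha> + \<beta> + \<gamma> + \<delta> = 0"
        and odd: "odd (?v \<alpha> + ?v \<beta> + ?v \<gamma> + ?v \<delta>)" and D: "\<bar>\<alpha>\<bar> + \<bar>\<beta>\<bar> + \<bar>\<gamma>\<bar> + \<bar>\<delta>\<bar> \<le> D"
        by (simp_all add: R_def)
      have p0: "p > 0"
        using p prime_gt_0_int by auto
      have dec: "\<exists>m'. m = p ^ ?v m * m' \<and> \<not> p dvd m'" if "m \<noteq> 0" for m
        using multiplicity_decompose'[of m p] that p not_prime_unit by metis
      define e where "e = ?v \<delta>"
      obtain a' where a': "\<alpha> = p ^ ?v \<alpha> * a'" "\<not> p dvd a'" using dec nz by blast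
      obtain b' where b': "\<beta> = p ^ ?v \<beta> * b'" "\<not> p dvd b'" using dec nz by blast
      obtain c' where c': "\<gamma> = p ^ ?v \<gamma> * c'" "\<not> p dvd c'" using dec nz by blast
      obtain d' where d': "\<delta> = p ^ ?v \<delta> * d'" "\<not> p dvd d'" using dec nz by blast
      have "p ^ e \<noteq> 0"
        using p0 by simp
      have split: "p ^ n = p ^ e * p ^ (n - e)" if "e \<le> n" for n
        using that by (simp add: power_add[symmetric])
      have eqs: "\<alpha> = p ^ e * (p ^ (?v \<alpha> - e) * a')" "\<beta> = p ^ e * (p ^ (?v \<beta> - e) * b')"
        "\<gamma> = p ^ e * (p ^ (?v \<gamma> - e) * c')" "\<delta> = p ^ e * d'"
        using a'(1) b'(1) c'(1) d'(1) split[of "?v \<alpha>"] split[of "?v \<beta>"] split[of "?v \<gamma>"] v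
        by (simp_all add: e_def)
      have "p ^ e * (p ^ (?v \<alpha> - e) * a' + p ^ (?v \<beta> - e) * b' + p ^ (?v \<gamma> - e) * c' + d') = 0"
        using sum eqs by (simp add: distrib_left)
      then have sum': "p ^ (?v \<alpha> - e) * a' + p ^ (?v \<beta> - e) * b' + p ^ (?v \<gamma> - e) * c' + d' = 0"
        using \<open>p ^ e \<noteq> 0\<close> mult_eq_0_iff by blast
      \<comment> \<open>The least valuation occurs twice; otherwise the zero sum would make d'
        divisible by p.\<close>
      have ve: "?v \<gamma> = e"
      proof (rule ccontr)
        assume "?v \<gamma> \<noteq> e"
        then have "0 < ?v \<alpha> - e" "0 < ?v \<beta> - e" "0 < ?v \<gamma> - e"
          using v by (auto simp: e_def)
        then have "p dvd p ^ (?v \<alpha> - e) * a' + p ^ (?v \<beta> - e) * b' + p ^ (?v \<gamma> - e) * c'"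
          by (intro dvd_add dvd_mult2) (auto simp: dvd_power)
        moreover have "d' = - (p ^ (?v \<alpha> - e) * a' + p ^ (?v \<beta> - e) * b' + p ^ (?v \<gamma> - e) * c')"
          using sum' by linarith
        ultimately show False
          using d'(2) dvd_minus_iff by metis
      qed
      define k l where "k = ?v \<alpha> - e" and "l = ?v \<beta> - e"
      have eqs': "\<alpha> = p ^ e * (p ^ k * a')" "\<beta> = p ^ e * (p ^ l * b')" "\<gamma> = p ^ e * c'" "\<delta> = p ^ e * d'"
        using eqs ve by (simp_all add: k_def l_def)
      \<comment> \<open>The two least valuations are equal and contribute an even amount; the other
        two therefore differ in parity, so strictly.\<close>
      have "odd (?v \<alpha> + ?v \<beta>)"
        using odd ve unfolding e_def by auto
      moreover from this have "?v \<beta> < ?v \<alpha>"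
        using v(3) by (auto simp: le_less)
      ultimately have kl: "odd (k + l)" "l < k"
        using v ve by (auto simp: k_def l_def e_def even_diff_nat)
      obtain u v where uv: "0 \<le> u" "0 \<le> v"
        "\<forall>s t. p dvd s\<^sup>2 + u * s * t + v * t\<^sup>2 \<longrightarrow> p dvd s \<and> p dvd t"
        using exists_anisotropic_binary_form[OF p] by (elim exE conjE)
      interpret ramified_form p k l a' b' c' d' u v
      proof
        show "p ^ k * a' + p ^ l * b' + c' + d' = 0"
          using sum' by (simp add: k_def l_def ve)
        show "p dvd s \<and> p dvd t" if "p dvd s\<^sup>2 + u * s * t + v * t\<^sup>2" for s t
          using uv(3) that by blast
      qed (use p kl a'(2) b'(2) c'(2) d'(2) uv(1,2) in blast)+
      have le: "\<bar>m\<bar> \<le> \<bar>p ^ e * m\<bar>" for m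
        using p0 by (simp add: abs_mult mult_le_cancel_right1)
      have "\<bar>p ^ k * a'\<bar> + \<bar>p ^ l * b'\<bar> + \<bar>c'\<bar> + \<bar>d'\<bar> \<le> \<bar>\<alpha>\<bar> + \<bar>\<beta>\<bar> + \<bar>\<gamma>\<bar> + \<bar>\<delta>\<bar>"
        using le[of "p ^ k * a'"] le[of "p ^ l * b'"] le[of c'] le[of d']
        by (simp only: eqs')
      moreover have "D > 0"
        using D nz by linarith
      ultimately obtain A M where A: "finite A" "0 < M" "A \<subseteq> {0..<M}"
        "only_trivial (p ^ k * a') (p ^ l * b') c' d' A" "D * M < int (card A) ^ 2"
        using exists_large_only_trivial[of D] D by auto
      have "\<alpha> * x + \<beta> * y + \<gamma> * z + \<delta> * w = p ^ e * (p ^ k * a' * x + p ^ l * b' * y + c' * z + d' * w)"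
        for x y z w
        by (simp only: eqs') (simp add: algebra_simps)
      then have "only_trivial \<alpha> \<beta> \<gamma> \<delta> A"
        using A(4) p0 by (simp add: only_trivial_def)
      then show "E \<alpha> \<beta> \<gamma> \<delta>"
        using A unfolding E_def by blast
    qed
  next
    fix \<alpha> \<beta> \<gamma> \<delta> :: int
    assume RE: "R \<alpha> \<beta> \<gamma> \<delta> \<longrightarrow> E \<alpha> \<beta> \<gamma> \<delta>"
    have "R \<beta> \<alpha> \<gamma> \<delta> \<longleftrightarrow> R \<alpha> \<beta> \<gamma> \<delta>" "R \<alpha> \<gamma> \<beta> \<delta> \<longleftrightarrow> R \<alpha> \<beta> \<gamma> \<delta>" "R \<alpha> \<beta> \<delta> \<gamma> \<longleftrightarrow> R \<alpha> \<beta> \<gamma> \<delta>"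
      unfolding R_def by (auto simp: ac_simps)
    moreover have "E \<beta> \<alpha> \<gamma> \<delta>" "E \<alpha> \<gamma> \<beta> \<delta>" "E \<alpha> \<beta> \<delta> \<gamma>" if "E \<alpha> \<beta> \<gamma> \<delta>"
      using that only_trivial_swap unfolding E_def by meson+
    ultimately show "R \<beta> \<alpha> \<gamma> \<delta> \<longrightarrow> E \<beta> \<alpha> \<gamma> \<delta>" "R \<alpha> \<gamma> \<beta> \<delta> \<longrightarrow> E \<alpha> \<gamma> \<beta> \<delta>" "R \<alpha> \<beta> \<delta> \<gamma> \<longrightarrow> E \<alpha> \<beta> \<delta> \<gamma>"
      using RE by blast+
  qed
  then show ?thesis
    using assms by (simp add: R_def E_def)
qed

section \<open>From one good set to all N\<close>

lemma exists_prime_odd_multiplicity: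
  fixes m :: int
  assumes "m > 0" "\<not> is_square m"
  obtains p where "prime p" "odd (multiplicity p m)"
  using assms is_nth_power_conv_multiplicity[of 2 m] by auto

text \<open>Words of length m over A, read in the carry-free base D M, form a power of A. One set
  whose squared size exceeds D M thus yields a power gain at all scales.\<close>

lemma only_trivial_power:
  fixes \<alpha> \<beta> \<gamma> \<delta> D M :: int
  assumes "only_trivial \<alpha> \<beta> \<gamma> \<delta> A" "finite A" "A \<subseteq> {0..<M}" "M > 0"
    and D: "\<bar>\<alpha>\<bar> + \<bar>\<beta>\<bar> + \<bar>\<gamma>\<bar> + \<bar>\<delta>\<bar> \<le> D" "D > 0" and sum: "\<alpha> + \<beta> + \<gamma> + \<delta> = 0"
  shows "\<exists>A'. only_trivial \<alpha> \<beta> \<gamma> \<delta> A' \<and> A' \<subseteq> {0..<(D * M) ^ m} \<and> card A' = card A ^ m"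
proof -
  define L where "L = {xs. set xs \<subseteq> A \<and> length xs = m}"
  let ?h = "horner_sum (\<lambda>x. x) (D * M)"
  have triv: "xs = ws \<and> ys = ws \<and> zs = ws"
    if P: "xs \<in> L" "ys \<in> L" "zs \<in> L" "ws \<in> L"
      and eq: "\<alpha> * ?h xs + \<beta> * ?h ys + \<gamma> * ?h zs + \<delta> * ?h ws = 0" for xs ys zs ws
  proof -
    have "xs ! i = ws ! i \<and> ys ! i = ws ! i \<and> zs ! i = ws ! i" if i: "i < m" for i
    proof -
      have "\<alpha> * (xs ! i) + \<beta> * (ys ! i) + \<gamma> * (zs ! i) + \<delta> * (ws ! i) = 0"
        by (rule horner_sum_no_carry[OF D, where M = M and f = "\<lambda>x. x"]) (use P i eq assms(3) in \<open>auto simp: L_def\<close>)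
      moreover have "xs ! i \<in> A" "ys ! i \<in> A" "zs ! i \<in> A" "ws ! i \<in> A"
        using P i by (auto simp: L_def subset_iff)
      ultimately show ?thesis
        using assms(1) by (simp add: only_trivial_def)
    qed
    then show ?thesis
      using P by (auto simp: L_def intro!: nth_equalityI)
  qed
  have inj: "inj_on ?h L" "only_trivial \<alpha> \<beta> \<gamma> \<delta> (?h ` L)"
    using inj_on_if_only_trivial[OF sum, of L ?h] triv by blast+
  have "?h xs \<in> {0..<(D * M) ^ m}" if "xs \<in> L" for xs
  proof -
    have "M \<le> D * M"
      using assms(4) D(2) by simp
    then have "(\<lambda>x. x) ` set xs \<subseteq> {0..<D * M}"
      using that assms(3) unfolding L_def image_ident mem_Collect_eq
      by (meson atLeastLessThan_iff order_less_le_trans subset_iff)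
    then show ?thesis
      using horner_sum_in_range[of "\<lambda>x. x" xs "D * M"] that assms(4) D(2) by (simp add: L_def)
  qed
  then have "?h ` L \<subseteq> {0..<(D * M) ^ m}"
    by blast
  moreover have "card (?h ` L) = card A ^ m"
    using card_image[OF inj(1)] card_lists_length_eq[OF assms(2), of m] by (simp add: L_def)
  ultimately show ?thesis
    using inj(2) by blast
qed

text \<open>Solutions are invariant under translation, which moves the range from 0 to 1. A constant
  solution has a single block, with coefficient sum zero.\<close>

lemma L_free_if_only_trivial:
  assumes "only_trivial \<alpha> \<beta> \<gamma> \<delta> A" "\<alpha> + \<beta> + \<gamma> + \<delta> = 0"
  shows "L_free [\<alpha>, \<beta>, \<gamma>, \<delta>] ((+) t ` A)"
  unfolding L_free_def
proof (intro allI impI)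
  fix xs assume xs: "set xs \<subseteq> (+) t ` A \<and> is_solution [\<alpha>, \<beta>, \<gamma>, \<delta>] xs"
  then have "length xs = 4"
    by (simp add: is_solution_def)
  then obtain x y z w where eq: "xs = [x, y, z, w]"
    by (auto simp: length_Suc_conv numeral_eq_Suc)
  have lin: "linear_form [\<alpha>, \<beta>, \<gamma>, \<delta>] [x, y, z, w] = \<alpha> * x + \<beta> * y + \<gamma> * z + \<delta> * w" for x y z w
    by (simp add: linear_form_def lessThan_Suc)
  obtain x' y' z' w' where A: "x' \<in> A" "y' \<in> A" "z' \<in> A" "w' \<in> A"
    and t: "x = t + x'" "y = t + y'" "z = t + z'" "w = t + w'"
    using xs by (auto simp: eq)
  have "\<alpha> * x + \<beta> * y + \<gamma> * z + \<delta> * w = \<alpha> * x' + \<beta> * y' + \<gamma> * z' + \<delta> * w' + (\<alpha> + \<beta> + \<gamma> + \<delta>) * t"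
    by (simp add: t algebra_simps)
  then have "\<alpha> * x' + \<beta> * y' + \<gamma> * z' + \<delta> * w' = 0"
    using xs assms(2) by (simp add: is_solution_def eq lin)
  then have "x' = w' \<and> y' = w' \<and> z' = w'"
    using assms(1) A by (simp add: only_trivial_def)
  then have eq': "xs = replicate 4 w"
    by (simp add: eq t numeral_eq_Suc)
  have "value_partition xs \<subseteq> {{..<4}}"
    by (auto simp: eq' value_partition_def quotient_def)
  moreover have "(\<Sum>i<4. [\<alpha>, \<beta>, \<gamma>, \<delta>] ! i) = 0"
    using assms(2) by (simp add: numeral_eq_Suc lessThan_Suc)
  ultimately show "trivial_solution [\<alpha>, \<beta>, \<gamma>, \<delta>] xs"
    using xs by (auto simp: trivial_solution_def)
qed

lemma card_le_r_L: "A \<subseteq> {1..int N} \<Longrightarrow> L_free cs A \<Longrightarrow> card A \<le> r_L cs N"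
  unfolding r_L_def by (rule Max_ge[OF finite_card_L_free]) blast

theorem theorem2:
  fixes a b c d :: int
  assumes "a > 0" "b > 0" "c > 0" "d > 0"
    and "a + b = c + d"
    and "\<not> is_square (a * b * c * d)"
  shows "\<exists>\<epsilon>>0. \<exists>C>0. \<forall>N::nat. N \<ge> 1 \<longrightarrow>
           real (r_L [a, b, -c, -d] N) \<ge> C * real N powr (1/2 + \<epsilon>)"
proof -
  define D where "D = a + b + c + d"
  have sum: "a + b + - c + - d = 0" and D: "\<bar>a\<bar> + \<bar>b\<bar> + \<bar>- c\<bar> + \<bar>- d\<bar> \<le> D" "D > 0" "D \<ge> 2"
    using assms by (simp_all add: D_def)
  obtain p where p: "prime p" "odd (multiplicity p (a * b * c * d))"
    using exists_prime_odd_multiplicity[of "a * b * c * d"] assms by auto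
  have "multiplicity p (a * b * c * d)
      = multiplicity p a + multiplicity p b + multiplicity p (- c) + multiplicity p (- d)"
    using prime_imp_prime_elem[OF p(1)] assms(1-4) by (simp add: prime_elem_multiplicity_mult_distrib)
  then obtain A M where A: "finite A" "0 < M" "A \<subseteq> {0..<M}" "only_trivial a b (- c) (- d) A"
    "D * M < int (card A) ^ 2"
    using exists_large_only_trivial_of_odd_multiplicity[OF p(1), of a b "- c" "- d" D] p(2) sum D assms
    by auto
  note M = \<open>0 < M\<close>
  have cA: "card A > 0"
  proof (rule ccontr)
    assume "\<not> card A > 0"
    then have "D * M < 0"
      using A(5) by simp
    then show False
      using D(2) M by (simp add: mult_less_0_iff)
  qed
  define g where "g = real_of_int (D * M)"
  define q where "q = real (card A)"
  have g: "g > 1" "g < q ^ 2"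
  proof -
    have "2 * 1 \<le> D * M"
      using D(3) M by (intro mult_mono) auto
    then have "1 < D * M"
      by simp
    then have "real_of_int 1 < real_of_int (D * M)"
      by (simp only: of_int_less_iff)
    then show "g > 1"
      by (simp add: g_def)
    have "real_of_int (D * M) < real_of_int (int (card A) ^ 2)"
      using A(5) by (simp only: of_int_less_iff)
    then show "g < q ^ 2"
      by (simp add: g_def q_def)
  qed
  have q: "q > 0"
    using cA by (simp add: q_def)
  \<comment> \<open>The exponent is log q / log g, which exceeds 1/2 because g < q^2.\<close>
  define \<epsilon> where "\<epsilon> = log g q - 1 / 2"
  have "log g g < log g (q ^ 2)"
    using g by (subst log_less_cancel_iff) auto
  then have "\<epsilon> > 0"
    using g q by (simp add: \<epsilon>_def log_nat_power)
  have gq: "g powr (1 / 2 + \<epsilon>) = q"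
    using g q by (simp add: \<epsilon>_def)
  have "1 / q * real N powr (1 / 2 + \<epsilon>) \<le> real (r_L [a, b, - c, - d] N)" if "N \<ge> 1" for N
  proof -
    \<comment> \<open>m is maximal with g^m at most N; rounding down loses at most the factor g^(1/2
      + \<epsilon>) = q, hence the constant 1/q.\<close>
    define m where "m = nat \<lfloor>log g (real N)\<rfloor>"
    have logN: "log g (real N) \<ge> 0"
      using that g by simp
    have m: "real m \<le> log g (real N)" "log g (real N) < real m + 1"
      using logN by (simp_all add: m_def)
    have lo: "g ^ m \<le> real N"
      using m(1) that g by (simp add: le_log_iff powr_realpow)
    have hi: "real N \<le> g ^ (m + 1)"
      using m(2) that g by (simp add: log_less_iff powr_add powr_realpow mult.commute)
    obtain A' where A': "only_trivial a b (- c) (- d) A'" "A' \<subseteq> {0..<(D * M) ^ m}" "card A' = card A ^ m"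
      using only_trivial_power[OF A(4,1,3) M D(1,2) sum] by blast
    have "real_of_int ((D * M) ^ m) \<le> real_of_int (int N)"
      using lo by (simp add: g_def)
    then have "(D * M) ^ m \<le> int N"
      by (simp only: of_int_le_iff)
    then have "(+) 1 ` A' \<subseteq> {1..int N}"
      using A'(2) by (force simp: subset_iff)
    then have "card ((+) 1 ` A') \<le> r_L [a, b, - c, - d] N"
      using L_free_if_only_trivial[OF A'(1) sum] by (rule card_le_r_L)
    moreover have "card ((+) 1 ` A') = card A ^ m"
      using A'(3) by (simp add: card_image)
    ultimately have "card A ^ m \<le> r_L [a, b, - c, - d] N"
      by simp
    then have "real (card A ^ m) \<le> real (r_L [a, b, - c, - d] N)"
      by (rule of_nat_mono)
    then have r: "q ^ m \<le> real (r_L [a, b, - c, - d] N)"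
      by (simp add: q_def)
    have "real N powr (1 / 2 + \<epsilon>) \<le> (g ^ (m + 1)) powr (1 / 2 + \<epsilon>)"
      using hi \<open>\<epsilon> > 0\<close> by (intro powr_mono2) auto
    also have "\<dots> = (g powr (1 / 2 + \<epsilon>)) ^ (m + 1)"
      using g by (simp add: powr_powr powr_realpow[symmetric] mult.commute del: power_Suc)
    finally have "real N powr (1 / 2 + \<epsilon>) \<le> q * q ^ m"
      by (simp add: gq)
    then have "1 / q * real N powr (1 / 2 + \<epsilon>) \<le> q ^ m"
      using q by (simp add: field_simps)
    with r show ?thesis
      by linarith
  qed
  then show ?thesis
    using \<open>\<epsilon> > 0\<close> q by (intro exI[of _ \<epsilon>] conjI exI[of _ "1 / q"]) auto
qed

end
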